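(* Let $(f^t,g^t,h^t)$ and $(\tilde f^{t+1},\tilde g^{t+1},\tilde h^{t+1})$, $t\in\mathbb{N}_0$, be generated by the Sinkhorn algorithm for entropic vector quantile regression started from $(f^0,g^0,h^0)\in\mathcal{C}_\diamond(\mathcal{U})\times\mathcal{C}_\diamond(\mathcal{U};\mathbb{R}^{d_x})\times\mathcal{C}(\mathcal{X}\times\mathcal{Y})$, and let $D_0:=D(f^0,g^0,h^0)$. Then for every $t\in\mathbb{N}_0$, $$\|\tilde f^{t+1}\|_\infty\vee\|f^{t+1}\|_\infty\le L_c\,\mathrm{diam}(\mathcal{U})+\|c\|_\infty+D_0^-+\|h^0\|_\infty=:K_f,$$ $$\|\tilde g^{t+1}\|_\infty\vee\|g^{t+1}\|_\infty\le4\|\Sigma_X^{-1}\|_{\mathrm{op}}M_x\left(4\|c\|_\infty-\frac32D_0+K_f+\|h^0\|_\infty+\varepsilon\log\left(\frac32\right)\right)=:K_g,$$ $$\|\tilde h^{t+1}\|_\infty\vee\|h^{t+1}\|_\infty\le\|c\|_\infty+K_f+K_gM_x .$$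
   Context: Setting. Let $(X,Y)$ be a random vector in $\mathbb{R}^{d_x}\times\mathbb{R}^{d_y}$ with law $\nu$; let $\mathcal{X}$, $\mathcal{Y}$ be the supports of $X$, $Y$. Let $\mu$ be a Borel probability measure on $\mathbb{R}^{d_y}$ with support $\mathcal{U}$. Assume $\mathcal{U},\mathcal{X},\mathcal{Y}$ are compact, $\mathbb{E}[X]=0$ and $\Sigma_X:=\mathbb{E}[XX^\top]$ is invertible. Fix $\varepsilon>0$; $c(u,y):=\|u-y\|^2/2$. The dual objective is $$D(f,g,h):=\int f\,d\mu+\int h\,d\nu-\varepsilon\left(\int e^{(f(u)+\langle g(u),x\rangle+h(x,y)-c(u,y))/\varepsilon}\,d(\mu\otimes\nu)(u,x,y)-1\right).$$ Notation. $M_x:=\sup_{x\in\mathcal{X}}\|x\|$; $\|c\|_\infty:=\sup_{\mathcal{U}\times\mathcal{Y}}c$; $L_c:=\sup_{u\in\mathcal{U}}\|u\|+\sup_{y\in\mathcal{Y}}\|y\|$; $a^-:=\max\{-a,0\}$; $a\vee b=\max\{a,b\}$. $\mathcal{C}_\diamond(\mathcal{U})$ (resp. $\mathcal{C}_\diamond(\mathcal{U};\mathbb{R}^{d_x})$) is the set of continuous $f:\mathcal{U}\to\mathbb{R}$ (resp. $g:\mathcal{U}\to\mathbb{R}^{d_x}$) with $\int f\,d\mu=0$ (resp. $\int g\,d\mu=0$). $\|\cdot\|_\infty$ is the sup norm over the domain ($\mathcal{U}$ or $\mathcal{X}\times\mathcal{Y}$), using the Euclidean norm for vector values. Sinkhorn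 algorithm. Given $(f^t,g^t,h^t)$: (1) for each $u\in\mathcal{U}$ let $\tilde g^{t+1}(u)\in\mathbb{R}^{d_x}$ be the (unique; continuous in $u$) vector with $\int x\,e^{(\langle\tilde g^{t+1}(u),x\rangle+h^t(x,y)-c(u,y))/\varepsilon}d\nu(x,y)=0$; (2) $\tilde f^{t+1}(u)=-\varepsilon\log\int e^{(\langle\tilde g^{t+1}(u),x\rangle+h^t(x,y)-c(u,y))/\varepsilon}d\nu(x,y)$ and $\tilde h^{t+1}(x,y)=-\varepsilon\log\int e^{(\tilde f^{t+1}(u)+\langle\tilde g^{t+1}(u),x\rangle-c(u,y))/\varepsilon}d\mu(u)$; (3) $f^{t+1}=\tilde f^{t+1}-\int\tilde f^{t+1}d\mu$, $g^{t+1}=\tilde g^{t+1}-\int\tilde g^{t+1}d\mu$, $h^{t+1}(x,y)=\tilde h^{t+1}(x,y)+\int\tilde f^{t+1}d\mu+\langle\int\tilde g^{t+1}d\mu,x\rangle$. *)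

theory Defs
  imports "HOL-Probability.Probability"
begin

definition measure_support :: "'a::topological_space measure \<Rightarrow> 'a set" where
  "measure_support M = {x. \<forall>V. open V \<and> x \<in> V \<longrightarrow> 0 < emeasure M V}"

text \<open>
  If \<open>\<nu>\<close> is the law of a pair \<open>(X, Y)\<close>, its two marginals are the laws of \<open>X\<close> and \<open>Y\<close>.
\<close>

definition suppX :: "('a::topological_space \<times> 'b::topological_space) measure \<Rightarrow> 'a set" where
  "suppX \<nu> = measure_support (distr \<nu> borel fst)"

definition suppY :: "('a::topological_space \<times> 'b::topological_space) measure \<Rightarrow> 'b set" where
  "suppY \<nu> = measure_support (distr \<nu> borel snd)"

text \<open>
  The supremum norm takes values in \<^typ>\<open>ereal\<close>, so that a bound on it really bounds the function.
\<close>

definition sup_norm :: "'a set \<Rightarrow> ('a \<Rightarrow> 'b::real_normed_vector) \<Rightarrow> ereal" where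
  "sup_norm S f = (SUP x\<in>S. ereal (norm (f x)))"

definition cost :: "'a::real_normed_vector \<Rightarrow> 'a \<Rightarrow> real" where
  "cost u y = (norm (u - y))\<^sup>2 / 2"

definition second_moment :: "'w measure \<Rightarrow> ('w \<Rightarrow> real ^ 'dx) \<Rightarrow> real ^ 'dx ^ 'dx" where
  "second_moment P X = (\<chi> i j. \<integral>\<omega>. X \<omega> $ i * X \<omega> $ j \<partial>P)"

text \<open>
  The potentials are functions on the supports, represented by total functions whose values
  outside are irrelevant. All integrals are therefore restricted to the supports, which have
  full measure.
\<close>

definition dual_objective ::
  "real \<Rightarrow> (real ^ 'dy) measure \<Rightarrow> ((real ^ 'dx) \<times> (real ^ 'dy)) measure \<Rightarrow>
   (real ^ 'dy \<Rightarrow> real) \<Rightarrow> (real ^ 'dy \<Rightarrow> real ^ 'dx) \<Rightarrow> ((real ^ 'dx) \<times> (real ^ 'dy) \<Rightarrow> real) \<Rightarrow> real" where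
  "dual_objective \<epsilon> \<mu> \<nu> f g h =
     (LINT u:measure_support \<mu>|\<mu>. f u) + (LINT z:suppX \<nu> \<times> suppY \<nu>|\<nu>. h z)
     - \<epsilon> * ((LINT (u, x, y):measure_support \<mu> \<times> suppX \<nu> \<times> suppY \<nu>|\<mu> \<Otimes>\<^sub>M \<nu>.
               exp ((f u + g u \<bullet> x + h (x, y) - cost u y) / \<epsilon>)) - 1)"

text \<open>
  One full iteration: \<open>(ft, gt, ht)\<close> are the unnormalised and \<open>(f', g', h')\<close> the normalised new
  potentials. The iteration depends on the old potentials only through \<open>h\<close>.
\<close>

definition sinkhorn_step ::
  "real \<Rightarrow> (real ^ 'dy) measure \<Rightarrow> ((real ^ 'dx) \<times> (real ^ 'dy)) measure \<Rightarrow>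
   ((real ^ 'dx) \<times> (real ^ 'dy) \<Rightarrow> real) \<Rightarrow>
   (real ^ 'dy \<Rightarrow> real) \<Rightarrow> (real ^ 'dy \<Rightarrow> real ^ 'dx) \<Rightarrow> ((real ^ 'dx) \<times> (real ^ 'dy) \<Rightarrow> real) \<Rightarrow>
   (real ^ 'dy \<Rightarrow> real) \<Rightarrow> (real ^ 'dy \<Rightarrow> real ^ 'dx) \<Rightarrow> ((real ^ 'dx) \<times> (real ^ 'dy) \<Rightarrow> real) \<Rightarrow> bool" where
  "sinkhorn_step \<epsilon> \<mu> \<nu> h ft gt ht f' g' h' \<longleftrightarrow>
     (\<forall>u \<in> measure_support \<mu>.
        (LINT (x, y):suppX \<nu> \<times> suppY \<nu>|\<nu>. exp ((gt u \<bullet> x + h (x, y) - cost u y) / \<epsilon>) *\<^sub>R x) = 0) \<and>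
     (\<forall>u \<in> measure_support \<mu>.
        ft u = - \<epsilon> * ln (LINT (x, y):suppX \<nu> \<times> suppY \<nu>|\<nu>.
                           exp ((gt u \<bullet> x + h (x, y) - cost u y) / \<epsilon>))) \<and>
     (\<forall>x \<in> suppX \<nu>. \<forall>y \<in> suppY \<nu>.
        ht (x, y) = - \<epsilon> * ln (LINT u:measure_support \<mu>|\<mu>.
                                exp ((ft u + gt u \<bullet> x - cost u y) / \<epsilon>))) \<and>
     (\<forall>u \<in> measure_support \<mu>. f' u = ft u - (LINT v:measure_support \<mu>|\<mu>. ft v)) \<and>
     (\<forall>u \<in> measure_support \<mu>. g' u = gt u - (LINT v:measure_support \<mu>|\<mu>. gt v)) \<and>
     (\<forall>x \<in> suppX \<nu>. \<forall>y \<in> suppY \<nu>.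
        h' (x, y) = ht (x, y) + (LINT v:measure_support \<mu>|\<mu>. ft v)
                    + (LINT v:measure_support \<mu>|\<mu>. gt v) \<bullet> x)"

end

theory Submission
  imports Defs
begin

text \<open>
  The moment condition is the first-order condition of a convex problem, so the first update maximises
  the dual objective over \<open>f\<close> and \<open>g\<close>: each \<open>ft u\<close> is a maximum over \<open>w\<close> of functions that are
  \<open>Lc\<close>-Lipschitz in \<open>u\<close>. The second update maximises over \<open>h\<close>, hence the dual objective never
  decreases, which bounds the integrals of \<open>h\<close> and \<open>ft\<close> from below; Jensen's inequality bounds them from
  above. For \<open>gt\<close>, the weight \<open>exp p\<close> with \<open>p = (ft u + gt u \<bullet> x + h (x, y) - cost u y) / \<epsilon>\<close> is a
  probability density, so the positive part of \<open>p\<close>, and with it that of \<open>gt u \<bullet> x\<close>, has bounded integral.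
  As \<open>X\<close> is centred, this bounds the integral of \<open>\<bar>gt u \<bullet> x\<bar>\<close>, which dominates a multiple of the norm of
  \<open>gt u\<close> because the covariance is invertible. The continuity of \<open>gt\<close>, needed to integrate it, follows
  from uniqueness, because a bounded map with closed graph is continuous.
\<close>

section \<open>Probability measures on compact sets\<close>

text \<open>The sharp constant is \<open>exp (- 1)\<close>; \<open>ln (3 / 2)\<close> is the one occurring in \<open>Kg\<close>.\<close>

lemma pos_part_le_ln_exp:
  fixes z :: real
  shows "max z 0 \<le> ln (3 / 2) * exp z"
proof -
  \<comment> \<open>The rational 2/5 separates the two constants:
    \<open>exp (- 1) \<le> 2 / 5\<close> by this line, and \<open>2 / 5 \<le> ln (3 / 2)\<close>
    because e^2 \<le> (3/2)^5.\<close>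
  have e: "(5 / 2 :: real) \<le> exp 1"
    using exp_lower_Taylor_quadratic[of 1] by simp
  have "exp (2 / 5 :: real) ^ 5 = exp 1 ^ 2"
    by (simp flip: exp_of_nat_mult)
  also have "\<dots> \<le> (272 / 100) ^ 2"
    using e_less_272 by (intro power_mono) auto
  also have "\<dots> \<le> (3 / 2 :: real) ^ 5"
    by (simp add: power_divide)
  finally have "exp (2 / 5 :: real) \<le> 3 / 2"
    by (rule power_le_imp_le_base[of _ 4, simplified]) simp
  then have ln: "2 / 5 \<le> ln (3 / 2 :: real)"
    by (subst ln_ge_iff) auto
  have "z \<le> exp (z - 1)"
    using exp_ge_add_one_self[of "z - 1"] by simp
  also have "\<dots> = exp z / exp 1"
    by (rule exp_diff)
  also have "\<dots> \<le> exp z / (5 / 2)"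
    using e by (intro divide_left_mono) auto
  also have "\<dots> \<le> ln (3 / 2) * exp z"
    using mult_right_mono[OF ln, of "exp z"] by simp
  finally show ?thesis
    using ln by simp
qed

text \<open>The complement of the support is covered by the null sets of a countable basis, and
  countably many null sets have a null union.\<close>

lemma AE_measure_support:
  fixes M :: "'a::second_countable_topology measure"
  assumes sets: "sets M = sets borel"
  shows "AE x in M. x \<in> measure_support M"
proof -
  obtain B :: "'a set set" where B: "countable B" "topological_basis B"
    using ex_countable_basis by blast
  define N where "N = {V \<in> B. emeasure M V = 0}"
  have "V \<in> null_sets M" if "V \<in> N" for V
    using that topological_basis_open[OF B(2)] by (auto simp: N_def null_sets_def sets)
  then have "\<Union> N \<in> null_sets M"
    using B(1) null_sets_UN'[of N "\<lambda>V. V" M] by (auto simp: N_def)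
  moreover have "x \<in> \<Union> N" if x: "x \<notin> measure_support M" for x
  proof -
    obtain V where V: "open V" "x \<in> V" "emeasure M V = 0"
      using x by (auto simp: measure_support_def zero_less_iff_neq_zero)
    then obtain W where W: "W \<in> B" "x \<in> W" "W \<subseteq> V"
      using B(2) topological_basisE by metis
    have "emeasure M W \<le> emeasure M V"
      using W V by (intro emeasure_mono) (auto simp: sets)
    then have "W \<in> N"
      using V W by (auto simp: N_def)
    then show ?thesis
      using W by blast
  qed
  ultimately show ?thesis
    by (intro AE_I'[of "\<Union> N"]) auto
qed

lemma compact_continuous_bounded:
  fixes q :: "'a::topological_space \<Rightarrow> 'b::real_normed_vector"
  assumes "compact K" "continuous_on K q"
  shows "\<exists>B. \<forall>x\<in>K. norm (q x) \<le> B"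
  using compact_imp_bounded[OF compact_continuous_image[OF assms(2,1)]]
  by (auto simp: bounded_iff)

text \<open>As the sigma-algebra is the trace on \<open>K\<close>, continuity on \<open>K\<close>
  alone gives measurability, and compactness gives boundedness, hence integrability.\<close>

locale compact_prob_space = prob_space M for M :: "'a::euclidean_space measure" +
  fixes K :: "'a set"
  assumes sets_eq: "sets M = sets (restrict_space borel K)" and compact: "compact K"
begin

lemma space_eq: "space M = K"
  using sets_eq_imp_space_eq[OF sets_eq] by (simp add: space_restrict_space)

lemma nonempty: "K \<noteq> {}"
  using not_empty space_eq by simp

lemma measurable_continuous:
  fixes q :: "'a \<Rightarrow> 'b::topological_space"
  assumes "continuous_on K q"
  shows "q \<in> borel_measurable M"
  using borel_measurable_continuous_on_restrict[OF assms] measurable_cong_sets[OF sets_eq refl]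
  by blast

lemma integrable_continuous:
  fixes q :: "'a \<Rightarrow> 'b::euclidean_space"
  assumes "continuous_on K q"
  shows "integrable M q"
proof -
  obtain B where "\<And>x. x \<in> K \<Longrightarrow> norm (q x) \<le> B"
    using compact_continuous_bounded[OF compact assms] by blast
  then show ?thesis
    by (intro integrable_const_bound[of _ B] measurable_continuous assms AE_I2)
      (auto simp: space_eq)
qed

lemma integral_continuous_mono:
  fixes p q :: "'a \<Rightarrow> real"
  assumes "continuous_on K p" "continuous_on K q" "\<And>x. x \<in> K \<Longrightarrow> p x \<le> q x"
  shows "(\<integral>x. p x \<partial>M) \<le> (\<integral>x. q x \<partial>M)"
  using assms by (intro integral_mono integrable_continuous) (auto simp: space_eq)

lemma integral_continuous_le:
  fixes q :: "'a \<Rightarrow> real"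
  assumes "continuous_on K q" "\<And>x. x \<in> K \<Longrightarrow> q x \<le> B"
  shows "(\<integral>x. q x \<partial>M) \<le> B"
  using integral_continuous_mono[of q "\<lambda>_. B"] assms by (simp add: prob_space)

lemma integral_continuous_ge:
  fixes q :: "'a \<Rightarrow> real"
  assumes "continuous_on K q" "\<And>x. x \<in> K \<Longrightarrow> B \<le> q x"
  shows "B \<le> (\<integral>x. q x \<partial>M)"
  using integral_continuous_mono[of "\<lambda>_. B" q] assms by (simp add: prob_space)

lemma norm_integral_continuous_le:
  fixes q :: "'a \<Rightarrow> 'b::euclidean_space"
  assumes "continuous_on K q" "\<And>x. x \<in> K \<Longrightarrow> norm (q x) \<le> B"
  shows "norm (\<integral>x. q x \<partial>M) \<le> B"
proof -
  have "norm (\<integral>x. q x \<partial>M) \<le> (\<integral>x. norm (q x) \<partial>M)"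
    by (rule integral_norm_bound)
  also have "\<dots> \<le> B"
    using assms by (intro integral_continuous_le continuous_on_norm)
  finally show ?thesis .
qed

text \<open>Jensen's inequality: integrate the tangent line of \<open>exp\<close> at the mean, which
  lies below \<open>exp\<close>.\<close>

lemma exp_integral_le:
  fixes q :: "'a \<Rightarrow> real"
  assumes "continuous_on K q"
  shows "exp (\<integral>x. q x \<partial>M) \<le> (\<integral>x. exp (q x) \<partial>M)"
proof -
  define m where "m = (\<integral>x. q x \<partial>M)"
  have "exp m = (\<integral>x. exp m * (1 + (q x - m)) \<partial>M)"
    using integrable_continuous[OF assms] by (simp add: m_def prob_space)
  also have "\<dots> \<le> (\<integral>x. exp (q x) \<partial>M)"
  proof (intro integral_continuous_mono continuous_intros assms)
    show "exp m * (1 + (q x - m)) \<le> exp (q x)" for x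
      using mult_left_mono[OF exp_ge_add_one_self[of "q x - m"], of "exp m"]
      by (simp flip: exp_add)
  qed
  finally show ?thesis
    by (simp add: m_def)
qed

lemma integral_exp_pos:
  fixes q :: "'a \<Rightarrow> real"
  assumes "continuous_on K q"
  shows "0 < (\<integral>x. exp (q x) \<partial>M)"
  using exp_integral_le[OF assms] exp_gt_zero less_le_trans by blast

text \<open>Dominated convergence along sequences; compactness of \<open>S \<times> K\<close>
  supplies a constant dominating function.\<close>

lemma continuous_on_integral:
  fixes q :: "'s::metric_space \<Rightarrow> 'a \<Rightarrow> 'b::euclidean_space"
  assumes "compact S" and cont: "continuous_on (S \<times> K) (\<lambda>(s, x). q s x)"
  shows "continuous_on S (\<lambda>s. \<integral>x. q s x \<partial>M)"
  unfolding continuous_on_sequentially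
proof (intro allI ballI impI)
  fix s a assume a: "a \<in> S" and s: "(\<forall>n. s n \<in> S) \<and> s \<longlonglongrightarrow> a"
  obtain B where B: "\<And>s x. s \<in> S \<Longrightarrow> x \<in> K \<Longrightarrow> norm (q s x) \<le> B"
    using compact_imp_bounded[OF compact_continuous_image[OF cont compact_Times[OF \<open>compact S\<close> compact]]]
    by (auto simp: bounded_iff)
  have meas: "q s \<in> borel_measurable M" if "s \<in> S" for s
    using that by (intro measurable_continuous continuous_on_compose2[OF cont, of K "\<lambda>x. (s, x)", simplified] continuous_intros) auto
  have "(\<lambda>n. \<integral>x. q (s n) x \<partial>M) \<longlonglongrightarrow> (\<integral>x. q a x \<partial>M)"
  proof (rule integral_dominated_convergence[where w = "\<lambda>_. B"])
    show "AE x in M. (\<lambda>n. q (s n) x) \<longlonglongrightarrow> q a x"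
    proof (rule AE_I2)
      fix x assume "x \<in> space M"
      then have "x \<in> K" by (simp add: space_eq)
      then have "continuous_on S (\<lambda>s. q s x)"
        by (intro continuous_on_compose2[OF cont, of S "\<lambda>s. (s, x)", simplified] continuous_intros) auto
      then show "(\<lambda>n. q (s n) x) \<longlonglongrightarrow> q a x"
        using a s by (auto simp: continuous_on_sequentially comp_def)
    qed
  qed (use a s meas B in \<open>auto simp: space_eq\<close>)
  then show "((\<lambda>s. \<integral>x. q s x \<partial>M) \<circ> s) \<longlonglongrightarrow> (\<integral>x. q a x \<partial>M)"
    by (simp add: comp_def)
qed

end

lemma compact_prob_space_restrict:
  fixes M :: "'a::euclidean_space measure"
  assumes "prob_space M" "sets M = sets borel" "compact K" "AE x in M. x \<in> K"
  shows "compact_prob_space (restrict_space M K) K"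
proof -
  interpret prob_space M by fact
  have K: "K \<in> sets M"
    using assms borel_compact by auto
  show ?thesis
  proof (intro compact_prob_space.intro prob_space_restrict_space compact_prob_space_axioms.intro)
    show "emeasure M K = 1"
      using assms K emeasure_eq_1_AE by blast
    show "sets (restrict_space M K) = sets (restrict_space borel K)"
      using assms by (intro sets_restrict_space_cong)
  qed (use assms K in auto)
qed

lemma set_integral_eq_restrict:
  fixes q :: "'a \<Rightarrow> 'b::{banach, second_countable_topology}"
  assumes "K \<inter> space M \<in> sets M"
  shows "(LINT x:K|M. q x) = (\<integral>x. q x \<partial>restrict_space M K)"
  using assms by (simp add: set_lebesgue_integral_def integral_restrict_space)

section \<open>The Sinkhorn updates\<close>

lemma continuous_on_cost [continuous_intros]:
  "continuous_on S p \<Longrightarrow> continuous_on S q \<Longrightarrow> continuous_on S (\<lambda>s. cost (p s) (q s))"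
  unfolding cost_def by (intro continuous_intros) auto

lemma cost_nonneg: "0 \<le> cost u y"
  by (simp add: cost_def)

text \<open>A difference of squares factors; the sum of the two distances is at most
  \<open>2 * L\<close> and their difference at most \<open>norm (u - v)\<close>.\<close>

lemma cost_diff_le:
  fixes u :: "'a::real_inner"
  assumes "norm u + norm y \<le> L" "norm v + norm y \<le> L"
  shows "cost u y - cost v y \<le> L * norm (u - v)"
proof -
  have "cost u y - cost v y = (norm (u - y) + norm (v - y)) * (norm (u - y) - norm (v - y)) / 2"
    by (simp add: cost_def power2_eq_square algebra_simps)
  also have "\<dots> \<le> (norm (u - y) + norm (v - y)) * norm (u - v) / 2"
    using norm_triangle_ineq2[of "u - y" "v - y"] by (intro divide_right_mono mult_left_mono) auto
  also have "\<dots> \<le> (2 * L) * norm (u - v) / 2"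
    using assms norm_triangle_ineq4[of u y] norm_triangle_ineq4[of v y]
    by (intro divide_right_mono mult_right_mono) auto
  finally show ?thesis by simp
qed

text \<open>\<open>A\<close> will be the operator norm of the inverse covariance times the bound on
  X, and \<open>norm_le_first_moment\<close> is the only form in which invertibility enters.
  \<open>C\<close> bounds the cost and \<open>L\<close> is its Lipschitz constant in
  \<open>u\<close>.\<close>

locale entropic_vqr =
  M: compact_prob_space M U + N: compact_prob_space N "XS \<times> YS"
  for M :: "'y::euclidean_space measure" and U
    and N :: "('x::euclidean_space \<times> 'y) measure" and XS YS +
  fixes \<epsilon> A C L :: real
  assumes eps_pos: "0 < \<epsilon>"
    and mean_zero: "(\<integral>z. fst z \<partial>N) = 0"
    and norm_le_first_moment: "norm v \<le> A * (\<integral>z. \<bar>v \<bullet> fst z\<bar> \<partial>N)"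
    and cost_le: "u \<in> U \<Longrightarrow> y \<in> YS \<Longrightarrow> cost u y \<le> C"
    and norm_sum_le: "u \<in> U \<Longrightarrow> y \<in> YS \<Longrightarrow> norm u + norm y \<le> L"
begin

section \<open>Updates and dual objective\<close>

definition slack :: "'x \<Rightarrow> ('x \<times> 'y \<Rightarrow> real) \<Rightarrow> 'y \<Rightarrow> 'x \<times> 'y \<Rightarrow> real" where
  "slack w h u z = w \<bullet> fst z + h z - cost u (snd z)"

definition f_update :: "'x \<Rightarrow> ('x \<times> 'y \<Rightarrow> real) \<Rightarrow> 'y \<Rightarrow> real" where
  "f_update w h u = - \<epsilon> * ln (\<integral>z. exp (slack w h u z / \<epsilon>) \<partial>N)"

definition h_update :: "('y \<Rightarrow> real) \<Rightarrow> ('y \<Rightarrow> 'x) \<Rightarrow> 'x \<times> 'y \<Rightarrow> real" where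
  "h_update f g z = - \<epsilon> * ln (\<integral>u. exp ((f u + g u \<bullet> fst z - cost u (snd z)) / \<epsilon>) \<partial>M)"

text \<open>The integral over the product is an iterated one here, which suits updates made
  pointwise in one variable; the final proof identifies it with
  \<open>dual_objective\<close>.\<close>

definition dual :: "('y \<Rightarrow> real) \<Rightarrow> ('y \<Rightarrow> 'x) \<Rightarrow> ('x \<times> 'y \<Rightarrow> real) \<Rightarrow> real" where
  "dual f g h = (\<integral>u. f u \<partial>M) + (\<integral>z. h z \<partial>N)
     - \<epsilon> * ((\<integral>u. \<integral>z. exp ((f u + slack (g u) h u z) / \<epsilon>) \<partial>N \<partial>M) - 1)"

lemma C_nonneg: "0 \<le> C"
proof -
  obtain u y where "u \<in> U" "y \<in> YS"
    using M.nonempty N.nonempty by auto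
  then show ?thesis
    using cost_le[of u y] cost_nonneg[of u y] by linarith
qed

lemma A_nonneg: "0 \<le> A"
proof (rule ccontr)
  assume "\<not> 0 \<le> A"
  obtain v :: 'x where v: "norm v = 1"
    using vector_choose_size[of 1] by auto
  have "A * (\<integral>z. \<bar>v \<bullet> fst z\<bar> \<partial>N) \<le> 0"
    using \<open>\<not> 0 \<le> A\<close> by (intro mult_nonpos_nonneg integral_nonneg_AE) auto
  then show False
    using norm_le_first_moment[of v] v by linarith
qed

lemma continuous_on_slack:
  assumes "continuous_on (XS \<times> YS) h"
  shows "continuous_on (XS \<times> YS) (slack w h u)"
  unfolding slack_def by (intro continuous_intros assms)

section \<open>The update of \<open>h\<close>\<close>

lemma h_update_continuous:
  assumes f: "continuous_on U f" and g: "continuous_on U g"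
  shows "continuous_on (XS \<times> YS) (h_update f g)"
proof -
  have f': "continuous_on ((XS \<times> YS) \<times> U) (\<lambda>s. f (snd s))"
    and g': "continuous_on ((XS \<times> YS) \<times> U) (\<lambda>s. g (snd s))"
    by (auto intro!: continuous_on_compose2[OF f] continuous_on_compose2[OF g] continuous_intros)
  have "continuous_on (XS \<times> YS) (\<lambda>z. \<integral>u. exp ((f u + g u \<bullet> fst z - cost u (snd z)) / \<epsilon>) \<partial>M)"
    by (intro M.continuous_on_integral N.compact, unfold case_prod_beta)
      (intro continuous_intros f' g', use eps_pos in auto)
  moreover have "(\<integral>u. exp ((f u + g u \<bullet> fst z - cost u (snd z)) / \<epsilon>) \<partial>M) > 0" for z
    using eps_pos by (intro M.integral_exp_pos continuous_intros f g) auto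
  ultimately show ?thesis
    unfolding h_update_def by (intro continuous_intros) (auto simp: less_imp_neq[symmetric] order_less_imp_not_eq2)
qed

text \<open>Jensen's inequality: as \<open>f\<close> and \<open>g\<close> have mean zero, only the
  mean of the cost survives in the exponent.\<close>

lemma h_update_le:
  assumes f: "continuous_on U f" and g: "continuous_on U g" and z: "z \<in> XS \<times> YS"
    and zero: "(\<integral>u. f u \<partial>M) = 0" "(\<integral>u. g u \<partial>M) = 0"
  shows "h_update f g z \<le> C"
proof -
  define q where "q u = (f u + g u \<bullet> fst z - cost u (snd z)) / \<epsilon>" for u
  have q: "continuous_on U q"
    unfolding q_def using eps_pos by (intro continuous_intros f g) auto
  have c: "continuous_on U (\<lambda>u. cost u (snd z))"
    by (intro continuous_intros)
  have "- C \<le> - (\<integral>u. cost u (snd z) \<partial>M)"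
    using z cost_le c by (auto intro!: M.integral_continuous_le)
  also have "\<dots> = \<epsilon> * (\<integral>u. q u \<partial>M)"
    unfolding q_def using eps_pos zero
      M.integrable_continuous[OF f] M.integrable_continuous[OF g] M.integrable_continuous[OF c]
    by simp
  also have "\<dots> \<le> \<epsilon> * ln (\<integral>u. exp (q u) \<partial>M)"
    using eps_pos M.exp_integral_le[OF q] M.integral_exp_pos[OF q]
    by (intro mult_left_mono) (auto simp: ln_ge_iff)
  finally show ?thesis
    by (simp add: h_update_def q_def)
qed

text \<open>The exponent \<open>q\<close> stays between \<open>- B\<close> and \<open>B\<close>, and
  so does \<open>\<epsilon>\<close> times the logarithm of the mean of
  \<open>exp (q / \<epsilon>)\<close>.\<close>

lemma abs_h_update_le:
  assumes f: "continuous_on U f" and g: "continuous_on U g"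
    and z: "z \<in> XS \<times> YS" and "norm (fst z) \<le> X"
    and bounds: "\<And>u. u \<in> U \<Longrightarrow> \<bar>f u\<bar> \<le> F" "\<And>u. u \<in> U \<Longrightarrow> norm (g u) \<le> G"
  shows "\<bar>h_update f g z\<bar> \<le> C + F + G * X"
proof -
  define q where "q u = f u + g u \<bullet> fst z - cost u (snd z)" for u
  define B where "B = C + F + G * X"
  have q: "continuous_on U (\<lambda>u. q u / \<epsilon>)"
    unfolding q_def using eps_pos by (intro continuous_intros f g) auto
  have qB: "\<bar>q u\<bar> \<le> B" if u: "u \<in> U" for u
  proof -
    have "\<bar>g u \<bullet> fst z\<bar> \<le> norm (g u) * norm (fst z)"
      by (rule Cauchy_Schwarz_ineq2)
    also have "\<dots> \<le> G * X"
      using bounds(2)[OF u] \<open>norm (fst z) \<le> X\<close> by (intro mult_mono) (auto intro: order_trans[OF norm_ge_zero])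
    finally show ?thesis
      using bounds(1)[OF u] cost_le[of u "snd z"] cost_nonneg[of u "snd z"] z u
      by (auto simp: q_def B_def)
  qed
  have "(\<integral>u. exp (q u / \<epsilon>) \<partial>M) \<le> exp (B / \<epsilon>)"
    using qB eps_pos by (intro M.integral_continuous_le continuous_on_exp q) (force simp: divide_right_mono)
  moreover have "exp (- B / \<epsilon>) \<le> (\<integral>u. exp (q u / \<epsilon>) \<partial>M)"
    using qB eps_pos
    by (intro M.integral_continuous_ge continuous_on_exp q) (fastforce simp: abs_le_iff intro: divide_right_mono simp flip: minus_divide_left)
  ultimately have "\<bar>ln (\<integral>u. exp (q u / \<epsilon>) \<partial>M)\<bar> \<le> B / \<epsilon>"
    using M.integral_exp_pos[OF q] ln_mono[of "exp (- B / \<epsilon>)" "\<integral>u. exp (q u / \<epsilon>) \<partial>M"]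
      ln_mono[of "\<integral>u. exp (q u / \<epsilon>) \<partial>M" "exp (B / \<epsilon>)"]
    by (simp add: abs_le_iff)
  then have "\<epsilon> * \<bar>ln (\<integral>u. exp (q u / \<epsilon>) \<partial>M)\<bar> \<le> \<epsilon> * (B / \<epsilon>)"
    using eps_pos by (intro mult_left_mono) auto
  then show ?thesis
    using eps_pos by (simp add: h_update_def q_def B_def abs_mult)
qed

text \<open>The logarithm in \<open>h_update\<close> divides by the normalising constant, so the
  exponential term of the dual objective cancels after this update.\<close>

lemma integral_exp_h_update:
  assumes f: "continuous_on U f" and g: "continuous_on U g"
  shows "(\<integral>u. exp ((f u + slack (g u) (h_update f g) u z) / \<epsilon>) \<partial>M) = 1"
proof -
  define I where "I = (\<integral>u. exp ((f u + g u \<bullet> fst z - cost u (snd z)) / \<epsilon>) \<partial>M)"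
  have I: "I > 0"
    unfolding I_def using eps_pos by (intro M.integral_exp_pos continuous_intros f g) auto
  have "(f u + slack (g u) (h_update f g) u z) / \<epsilon>
      = (f u + g u \<bullet> fst z - cost u (snd z)) / \<epsilon> - ln I" for u
    using eps_pos by (simp add: slack_def h_update_def field_simps flip: I_def)
  then have "exp ((f u + slack (g u) (h_update f g) u z) / \<epsilon>)
      = exp ((f u + g u \<bullet> fst z - cost u (snd z)) / \<epsilon>) / I" for u
    using I by (simp add: exp_diff)
  then show ?thesis
    using I by (simp add: I_def[symmetric])
qed

text \<open>Pointwise optimality of the update: \<open>ln x \<le> x - 1\<close> at
  \<open>x = I * exp (h z / \<epsilon>)\<close>.\<close>

lemma le_h_update:
  assumes f: "continuous_on U f" and g: "continuous_on U g"
  shows "h z - \<epsilon> * ((\<integral>u. exp ((f u + slack (g u) h u z) / \<epsilon>) \<partial>M) - 1) \<le> h_update f g z"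
proof -
  define I where "I = (\<integral>u. exp ((f u + g u \<bullet> fst z - cost u (snd z)) / \<epsilon>) \<partial>M)"
  have I: "I > 0"
    unfolding I_def using eps_pos by (intro M.integral_exp_pos continuous_intros f g) auto
  have "exp ((f u + slack (g u) h u z) / \<epsilon>)
      = exp ((f u + g u \<bullet> fst z - cost u (snd z)) / \<epsilon>) * exp (h z / \<epsilon>)" for u
    by (simp add: slack_def add_divide_distrib diff_divide_distrib flip: exp_add)
  then have "(\<integral>u. exp ((f u + slack (g u) h u z) / \<epsilon>) \<partial>M) = I * exp (h z / \<epsilon>)"
    by (simp add: I_def)
  moreover have "\<epsilon> * (h z / \<epsilon> + ln I) \<le> \<epsilon> * (I * exp (h z / \<epsilon>) - 1)"
    using eps_pos I ln_le_minus_one[of "I * exp (h z / \<epsilon>)"]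
    by (intro mult_left_mono) (auto simp: ln_mult)
  ultimately show ?thesis
    using eps_pos by (simp add: h_update_def algebra_simps flip: I_def)
qed

text \<open>Normalising \<open>f\<close> and \<open>g\<close> turns the updated \<open>h\<close>
  into the update of the normalised pair, which is what the last step of the algorithm
  computes.\<close>

lemma h_update_shift:
  assumes f: "continuous_on U f" and g: "continuous_on U g"
  shows "h_update (\<lambda>u. f u - a) (\<lambda>u. g u - b) z = h_update f g z + a + b \<bullet> fst z"
proof -
  define I where "I = (\<integral>u. exp ((f u + g u \<bullet> fst z - cost u (snd z)) / \<epsilon>) \<partial>M)"
  have I: "I > 0"
    unfolding I_def using eps_pos by (intro M.integral_exp_pos continuous_intros f g) auto
  have "exp ((f u - a + (g u - b) \<bullet> fst z - cost u (snd z)) / \<epsilon>)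
      = exp ((f u + g u \<bullet> fst z - cost u (snd z)) / \<epsilon>) * exp (- (a + b \<bullet> fst z) / \<epsilon>)" for u
    by (simp add: algebra_simps add_divide_distrib diff_divide_distrib flip: exp_add)
  then have "h_update (\<lambda>u. f u - a) (\<lambda>u. g u - b) z = - \<epsilon> * ln (I * exp (- (a + b \<bullet> fst z) / \<epsilon>))"
    by (simp add: h_update_def I_def)
  also have "\<dots> = - \<epsilon> * ln I + a + b \<bullet> fst z"
    using I eps_pos by (simp add: ln_mult field_simps)
  finally show ?thesis
    by (simp add: h_update_def I_def)
qed

lemma integral_swap:
  assumes f: "continuous_on U f" and g: "continuous_on U g" and h: "continuous_on (XS \<times> YS) h"
  shows "(\<integral>u. \<integral>z. exp ((f u + slack (g u) h u z) / \<epsilon>) \<partial>N \<partial>M)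
       = (\<integral>z. \<integral>u. exp ((f u + slack (g u) h u z) / \<epsilon>) \<partial>M \<partial>N)"
proof -
  interpret MN: pair_prob_space M N ..
  have K: "compact (U \<times> (XS \<times> YS))"
    by (intro compact_Times M.compact N.compact)
  have f': "continuous_on (U \<times> (XS \<times> YS)) (\<lambda>s. f (fst s))"
    and g': "continuous_on (U \<times> (XS \<times> YS)) (\<lambda>s. g (fst s))"
    and h': "continuous_on (U \<times> (XS \<times> YS)) (\<lambda>s. h (snd s))"
    by (auto intro!: continuous_on_compose2[OF f] continuous_on_compose2[OF g]
        continuous_on_compose2[OF h] continuous_intros)
  define E where "E s = exp ((f (fst s) + slack (g (fst s)) h (fst s) (snd s)) / \<epsilon>)" for s
  have "continuous_on (U \<times> (XS \<times> YS)) E"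
    unfolding E_def slack_def by (intro continuous_intros f' g' h') (use eps_pos in auto)
  then obtain B where B: "\<forall>s\<in>U \<times> (XS \<times> YS). norm (E s) \<le> B"
    using compact_continuous_bounded[OF K] by blast
  \<comment> \<open>Joint continuity supplies the bound on \<open>E\<close>; measurability on the
    product is assembled from functions of a single coordinate.\<close>
  have fst: "(\<lambda>s. p (fst s)) \<in> borel_measurable (M \<Otimes>\<^sub>M N)" if "continuous_on U p"
    for p :: "'y \<Rightarrow> 'c::topological_space"
    using measurable_compose[OF measurable_fst M.measurable_continuous[OF that]] .
  have snd: "(\<lambda>s. p (snd s)) \<in> borel_measurable (M \<Otimes>\<^sub>M N)" if "continuous_on (XS \<times> YS) p"
    for p :: "'x \<times> 'y \<Rightarrow> 'c::topological_space"
    using measurable_compose[OF measurable_snd N.measurable_continuous[OF that]] .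
  have "integrable (M \<Otimes>\<^sub>M N) E"
  proof (rule MN.integrable_const_bound[where B = B])
    show "AE s in M \<Otimes>\<^sub>M N. norm (E s) \<le> B"
      using B by (intro AE_I2) (auto simp: space_pair_measure M.space_eq N.space_eq)
    have "(\<lambda>s. f (fst s)) \<in> borel_measurable (M \<Otimes>\<^sub>M N)"
      "(\<lambda>s. g (fst s) \<bullet> fst (snd s)) \<in> borel_measurable (M \<Otimes>\<^sub>M N)"
      "(\<lambda>s. h (snd s)) \<in> borel_measurable (M \<Otimes>\<^sub>M N)"
      by (intro borel_measurable_inner fst snd f g h continuous_intros)+
    moreover have "(\<lambda>s. fst s - snd (snd s)) \<in> borel_measurable (M \<Otimes>\<^sub>M N)"
      by (intro borel_measurable_diff fst snd continuous_intros)
    then have "(\<lambda>s. cost (fst s) (snd (snd s))) \<in> borel_measurable (M \<Otimes>\<^sub>M N)"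
      unfolding cost_def
      using measurable_compose[OF _ borel_measurable_norm]
      by (intro borel_measurable_divide borel_measurable_power borel_measurable_const) auto
    ultimately show "E \<in> borel_measurable (M \<Otimes>\<^sub>M N)"
      unfolding E_def slack_def
      by (intro borel_measurable_exp[THEN measurable_compose[rotated]] borel_measurable_divide
        borel_measurable_add borel_measurable_diff borel_measurable_const)
  qed
  then have "integrable (M \<Otimes>\<^sub>M N) (\<lambda>(u, z). E (u, z))"
    by (simp only: case_prod_eta)
  from MN.Fubini_integral[OF this] show ?thesis
    unfolding E_def fst_conv snd_conv by (rule sym)
qed

section \<open>The update of \<open>f\<close> and the moment condition\<close>

text \<open>Jensen's inequality again. X is centred, so the linear term integrates to zero and the
  bound does not depend on \<open>w\<close>.\<close>

lemma f_update_le: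
  assumes h: "continuous_on (XS \<times> YS) h" and u: "u \<in> U"
  shows "f_update w h u \<le> C - (\<integral>z. h z \<partial>N)"
proof -
  have q: "continuous_on (XS \<times> YS) (\<lambda>z. slack w h u z / \<epsilon>)"
    using eps_pos by (intro continuous_intros continuous_on_slack h) auto
  have c: "continuous_on (XS \<times> YS) (\<lambda>z. cost u (snd z))"
    by (intro continuous_intros)
  have "- C + (\<integral>z. h z \<partial>N) \<le> - (\<integral>z. cost u (snd z) \<partial>N) + (\<integral>z. h z \<partial>N)"
    using u cost_le c by (auto intro!: N.integral_continuous_le)
  also have "\<dots> = \<epsilon> * (\<integral>z. slack w h u z / \<epsilon> \<partial>N)"
    unfolding slack_def using eps_pos mean_zero N.integrable_continuous[OF h]
      N.integrable_continuous[OF c]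
      N.integrable_continuous[OF continuous_on_fst[OF continuous_on_id]]
    by simp
  also have "\<dots> \<le> \<epsilon> * ln (\<integral>z. exp (slack w h u z / \<epsilon>) \<partial>N)"
    using eps_pos N.exp_integral_le[OF q] N.integral_exp_pos[OF q]
    by (intro mult_left_mono) (auto simp: ln_ge_iff)
  finally show ?thesis
    by (simp add: f_update_def)
qed

text \<open>
  The moment condition is the first-order condition for minimising the convex function
  \<open>v \<mapsto> \<integral>exp (slack v h u z / \<epsilon>) \<partial>N\<close>.
\<close>

definition optimal :: "('x \<times> 'y \<Rightarrow> real) \<Rightarrow> 'y \<Rightarrow> 'x \<Rightarrow> bool" where
  "optimal h u w \<longleftrightarrow> (\<integral>z. exp (slack w h u z / \<epsilon>) *\<^sub>R fst z \<partial>N) = 0"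

text \<open>The convex integrand lies above its tangent at \<open>w\<close>, and the linear term of
  the tangent integrates to zero by the moment condition.\<close>

lemma optimal_imp_f_update_le:
  assumes h: "continuous_on (XS \<times> YS) h" and w: "optimal h u w"
  shows "f_update v h u \<le> f_update w h u"
proof -
  let ?a = "\<lambda>z. slack w h u z / \<epsilon>" and ?b = "\<lambda>z. slack v h u z / \<epsilon>"
  define d where "d = (v - w) /\<^sub>R \<epsilon>"
  have a: "continuous_on (XS \<times> YS) ?a" and b: "continuous_on (XS \<times> YS) ?b"
    using eps_pos by (auto intro!: continuous_intros continuous_on_slack h)
  have ba: "?b z = ?a z + d \<bullet> fst z" for z
    using eps_pos by (simp add: slack_def d_def inner_diff_left field_simps)
  have ax: "continuous_on (XS \<times> YS) (\<lambda>z. exp (?a z) *\<^sub>R fst z)"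
    by (intro continuous_on_scaleR continuous_on_exp continuous_on_fst continuous_on_id a)
  have "(\<integral>z. exp (?a z) \<partial>N) = (\<integral>z. exp (?a z) + d \<bullet> (exp (?a z) *\<^sub>R fst z) \<partial>N)"
    using w N.integrable_continuous[OF continuous_on_exp[OF a]] N.integrable_continuous[OF ax]
    by (simp add: optimal_def integral_inner_right del: inner_scaleR_right)
  also have "\<dots> \<le> (\<integral>z. exp (?b z) \<partial>N)"
  proof (intro N.integral_continuous_mono continuous_on_add continuous_on_inner continuous_on_const continuous_on_exp ax a b)
    show "exp (?a z) + d \<bullet> (exp (?a z) *\<^sub>R fst z) \<le> exp (?b z)" for z
      using mult_left_mono[OF exp_ge_add_one_self[of "d \<bullet> fst z"], of "exp (?a z)"]
      unfolding ba exp_add by (simp add: algebra_simps)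
  qed
  finally show ?thesis
    using eps_pos N.integral_exp_pos[OF a] by (simp add: f_update_def ln_mono)
qed

text \<open>Compare with the competitor \<open>0\<close>, whose slack is at most \<open>h\<close>
  because the cost is nonnegative.\<close>

lemma optimal_imp_f_update_ge:
  assumes h: "continuous_on (XS \<times> YS) h" and w: "optimal h u w"
    and H: "\<And>z. z \<in> XS \<times> YS \<Longrightarrow> h z \<le> H"
  shows "- H \<le> f_update w h u"
proof -
  have q: "continuous_on (XS \<times> YS) (\<lambda>z. slack 0 h u z / \<epsilon>)"
    using eps_pos by (intro continuous_intros continuous_on_slack h) auto
  have "(\<integral>z. exp (slack 0 h u z / \<epsilon>) \<partial>N) \<le> exp (H / \<epsilon>)"
  proof (intro N.integral_continuous_le continuous_on_exp q)
    fix z assume "z \<in> XS \<times> YS"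
    then have "slack 0 h u z \<le> H"
      using H[of z] cost_nonneg[of u "snd z"] by (simp add: slack_def)
    then show "exp (slack 0 h u z / \<epsilon>) \<le> exp (H / \<epsilon>)"
      using eps_pos by (simp add: divide_right_mono)
  qed
  then have "ln (\<integral>z. exp (slack 0 h u z / \<epsilon>) \<partial>N) \<le> H / \<epsilon>"
    using N.integral_exp_pos[OF q] ln_mono[of _ "exp (H / \<epsilon>)"] by fastforce
  then have "\<epsilon> * ln (\<integral>z. exp (slack 0 h u z / \<epsilon>) \<partial>N) \<le> \<epsilon> * (H / \<epsilon>)"
    using eps_pos by (intro mult_left_mono) auto
  then have "- H \<le> f_update 0 h u"
    using eps_pos by (simp add: f_update_def)
  with optimal_imp_f_update_le[OF h w, of 0] show ?thesis
    by simp
qed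

text \<open>For fixed \<open>w\<close> the Lipschitz bound of the cost passes through the logarithm
  of the integral; optimality at \<open>u'\<close> then replaces \<open>w\<close> by
  \<open>w'\<close>.\<close>

lemma f_update_diff_le:
  assumes h: "continuous_on (XS \<times> YS) h" and u: "u \<in> U" "u' \<in> U" and w': "optimal h u' w'"
  shows "f_update w h u - f_update w' h u' \<le> L * norm (u - u')"
proof -
  let ?d = "L * norm (u - u')"
  have q: "continuous_on (XS \<times> YS) (\<lambda>z. slack w h v z / \<epsilon>)" for v
    using eps_pos by (intro continuous_intros continuous_on_slack h) auto
  have "(\<integral>z. exp (slack w h u' z / \<epsilon>) \<partial>N) \<le> (\<integral>z. exp (?d / \<epsilon>) * exp (slack w h u z / \<epsilon>) \<partial>N)"
  proof (intro N.integral_continuous_mono continuous_on_mult continuous_on_const continuous_on_exp q)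
    fix z assume "z \<in> XS \<times> YS"
    then have "cost u (snd z) - cost u' (snd z) \<le> ?d"
      using u by (intro cost_diff_le norm_sum_le) auto
    then have "slack w h u' z \<le> ?d + slack w h u z"
      by (simp add: slack_def)
    then show "exp (slack w h u' z / \<epsilon>) \<le> exp (?d / \<epsilon>) * exp (slack w h u z / \<epsilon>)"
      using eps_pos by (simp add: divide_right_mono flip: exp_add add_divide_distrib)
  qed
  also have "\<dots> = exp (?d / \<epsilon>) * (\<integral>z. exp (slack w h u z / \<epsilon>) \<partial>N)"
    by simp
  finally have "ln (\<integral>z. exp (slack w h u' z / \<epsilon>) \<partial>N)
      \<le> ln (exp (?d / \<epsilon>) * (\<integral>z. exp (slack w h u z / \<epsilon>) \<partial>N))"
    using N.integral_exp_pos[OF q] by (intro ln_mono) auto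
  also have "\<dots> = ?d / \<epsilon> + ln (\<integral>z. exp (slack w h u z / \<epsilon>) \<partial>N)"
    using N.integral_exp_pos[OF q[of u]] by (simp add: ln_mult)
  finally have "\<epsilon> * ln (\<integral>z. exp (slack w h u' z / \<epsilon>) \<partial>N)
      \<le> \<epsilon> * (?d / \<epsilon> + ln (\<integral>z. exp (slack w h u z / \<epsilon>) \<partial>N))"
    using eps_pos by (intro mult_left_mono) auto
  then have "f_update w h u - f_update w h u' \<le> ?d"
    using eps_pos by (simp add: f_update_def distrib_left)
  with optimal_imp_f_update_le[OF h w', of w] show ?thesis
    by simp
qed

section \<open>Size, uniqueness and continuity of the optimiser\<close>

lemma integral_exp_f_update:
  assumes h: "continuous_on (XS \<times> YS) h"
  shows "(\<integral>z. exp ((f_update w h u + slack w h u z) / \<epsilon>) \<partial>N) = 1"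
proof -
  define I where "I = (\<integral>z. exp (slack w h u z / \<epsilon>) \<partial>N)"
  have I: "I > 0"
    unfolding I_def using eps_pos by (intro N.integral_exp_pos continuous_intros continuous_on_slack h) auto
  have "(f_update w h u + slack w h u z) / \<epsilon> = slack w h u z / \<epsilon> - ln I" for z
    using eps_pos by (simp add: f_update_def field_simps flip: I_def)
  then have "exp ((f_update w h u + slack w h u z) / \<epsilon>) = exp (slack w h u z / \<epsilon>) / I" for z
    using I by (simp add: exp_diff)
  then show ?thesis
    using I by (simp add: I_def[symmetric])
qed

text \<open>The bounds \<open>F\<close> and \<open>H\<close> are free because the estimate serves
  twice: with crude ones for the continuity of the optimiser, and with those behind
  \<open>Kg\<close> in a Sinkhorn step.\<close>

lemma norm_le_of_f_update_ge:
  assumes h: "continuous_on (XS \<times> YS) h" and u: "u \<in> U"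
    and F: "0 \<le> F" "- F \<le> f_update w h u" and H: "(\<integral>z. max (- h z) 0 \<partial>N) \<le> H"
  shows "norm w \<le> 2 * A * (\<epsilon> * ln (3 / 2) + C + F + H)"
proof -
  let ?p = "\<lambda>z. (f_update w h u + slack w h u z) / \<epsilon>"
  have p: "continuous_on (XS \<times> YS) ?p"
    using eps_pos by (intro continuous_intros continuous_on_slack h) auto
  have x: "continuous_on (XS \<times> YS) (\<lambda>z. w \<bullet> fst z)"
    by (intro continuous_intros)
  have h': "continuous_on (XS \<times> YS) (\<lambda>z. max (- h z) 0)"
    by (intro continuous_intros h)
  note int = N.integrable_continuous[OF p] N.integrable_continuous[OF h']
    N.integrable_continuous[OF continuous_on_exp[OF p]]
  have "(\<integral>z. max (w \<bullet> fst z) 0 \<partial>N)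
      \<le> (\<integral>z. \<epsilon> * ln (3 / 2) * exp (?p z) + (C + F) + max (- h z) 0 \<partial>N)"
  proof (intro N.integral_continuous_mono continuous_on_add continuous_on_mult continuous_on_max continuous_on_const continuous_on_minus continuous_on_exp p x h)
    fix z assume "z \<in> XS \<times> YS"
    then have c: "cost u (snd z) \<le> C"
      using u by (auto intro: cost_le)
    have "w \<bullet> fst z = \<epsilon> * ?p z - f_update w h u - h z + cost u (snd z)"
      using eps_pos by (simp add: slack_def)
    also have "\<dots> \<le> \<epsilon> * max (?p z) 0 + F + max (- h z) 0 + C"
      using c F(2) mult_left_mono[of "?p z" "max (?p z) 0" \<epsilon>] eps_pos by linarith
    finally have "max (w \<bullet> fst z) 0 \<le> \<epsilon> * max (?p z) 0 + F + max (- h z) 0 + C"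
      using eps_pos C_nonneg F(1) by simp
    \<comment> \<open>\<open>exp (?p z)\<close> integrates to one, so after integration the positive
      part of \<open>?p\<close> costs only the constant \<open>ln (3 / 2)\<close>.\<close>
    also have "\<epsilon> * max (?p z) 0 \<le> \<epsilon> * (ln (3 / 2) * exp (?p z))"
      using eps_pos by (intro mult_left_mono pos_part_le_ln_exp) auto
    finally show "max (w \<bullet> fst z) 0 \<le> \<epsilon> * ln (3 / 2) * exp (?p z) + (C + F) + max (- h z) 0"
      by simp
  qed
  also have "\<dots> = \<epsilon> * ln (3 / 2) + (C + F) + (\<integral>z. max (- h z) 0 \<partial>N)"
    using int by (simp add: integral_exp_f_update[OF h] N.prob_space)
  finally have pos: "(\<integral>z. max (w \<bullet> fst z) 0 \<partial>N) \<le> \<epsilon> * ln (3 / 2) + C + F + H"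
    using H by linarith
  \<comment> \<open>For a centred variable the absolute moment is twice that of the positive part;
    this is the factor 2 in the bound.\<close>
  have "(\<integral>z. \<bar>w \<bullet> fst z\<bar> \<partial>N) = (\<integral>z. 2 * max (w \<bullet> fst z) 0 - w \<bullet> fst z \<partial>N)"
    by (intro Bochner_Integration.integral_cong) auto
  also have "\<dots> = 2 * (\<integral>z. max (w \<bullet> fst z) 0 \<partial>N)"
    using N.integrable_continuous[OF x] mean_zero
      N.integrable_continuous[OF continuous_on_max[OF x continuous_on_const[of _ 0]]]
      N.integrable_continuous[OF continuous_on_fst[OF continuous_on_id]]
    by simp
  finally have "norm w \<le> A * (2 * (\<integral>z. max (w \<bullet> fst z) 0 \<partial>N))"
    using norm_le_first_moment[of w] by simp
  also have "\<dots> \<le> A * (2 * (\<epsilon> * ln (3 / 2) + C + F + H))"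
    using pos A_nonneg by (intro mult_left_mono) auto
  finally show ?thesis
    by (simp add: mult_ac)
qed

text \<open>Strict monotonicity of \<open>exp\<close>: for two solutions, \<open>p\<close> is
  nonnegative with integral zero, so \<open>d \<bullet> fst z\<close> vanishes almost everywhere and
  \<open>norm_le_first_moment\<close> forces \<open>d = 0\<close>.\<close>

lemma optimal_unique:
  assumes h: "continuous_on (XS \<times> YS) h" and "optimal h u v" "optimal h u w"
  shows "v = w"
proof -
  let ?a = "\<lambda>z. slack v h u z / \<epsilon>" and ?b = "\<lambda>z. slack w h u z / \<epsilon>"
  define d where "d = v - w"
  define p where "p z = (exp (?a z) - exp (?b z)) * (d \<bullet> fst z)" for z
  have a: "continuous_on (XS \<times> YS) ?a" and b: "continuous_on (XS \<times> YS) ?b"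
    using eps_pos by (auto intro!: continuous_intros continuous_on_slack h)
  have ab: "?a z = ?b z + d \<bullet> fst z / \<epsilon>" for z
    using eps_pos by (simp add: slack_def d_def inner_diff_left field_simps)
  have p: "continuous_on (XS \<times> YS) p"
    unfolding p_def by (intro continuous_on_mult continuous_on_diff continuous_on_exp continuous_on_inner continuous_intros a b)
  have ax: "continuous_on (XS \<times> YS) (\<lambda>z. exp (?a z) *\<^sub>R fst z)"
    and bx: "continuous_on (XS \<times> YS) (\<lambda>z. exp (?b z) *\<^sub>R fst z)"
    by (intro continuous_on_scaleR continuous_on_exp continuous_on_fst continuous_on_id a b)+
  have "p = (\<lambda>z. d \<bullet> (exp (?a z) *\<^sub>R fst z) - d \<bullet> (exp (?b z) *\<^sub>R fst z))"
    by (simp add: p_def algebra_simps fun_eq_iff)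
  then have "(\<integral>z. p z \<partial>N) = 0"
    using assms(2,3) N.integrable_continuous[OF ax] N.integrable_continuous[OF bx]
    by (simp add: optimal_def integral_inner_right del: inner_scaleR_right)
  moreover have sign: "0 \<le> p z \<and> (p z = 0 \<longrightarrow> d \<bullet> fst z = 0)" for z
  proof (cases "d \<bullet> fst z" "0 :: real" rule: linorder_cases)
    case less
    then have "?a z < ?b z"
      using eps_pos by (simp add: ab divide_neg_pos)
    then show ?thesis
      using less by (auto simp: p_def mult_nonpos_nonpos)
  next
    case greater
    then have "?b z < ?a z"
      using eps_pos by (simp add: ab)
    then show ?thesis
      using greater by (auto simp: p_def)
  qed (auto simp: p_def)
  ultimately have "AE z in N. p z = 0"
    using integral_nonneg_eq_0_iff_AE[OF N.integrable_continuous[OF p]] by simp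
  then have "AE z in N. \<bar>d \<bullet> fst z\<bar> = 0"
    using sign by auto
  then have "(\<integral>z. \<bar>d \<bullet> fst z\<bar> \<partial>N) = 0"
    by (rule integral_eq_zero_AE)
  then show ?thesis
    using norm_le_first_moment[of d] by (simp add: d_def)
qed

text \<open>All values of \<open>g\<close> lie in one ball, so the closed graph argument takes place
  in a compact set.\<close>

lemma optimal_continuous:
  assumes h: "continuous_on (XS \<times> YS) h" and opt: "\<And>u. u \<in> U \<Longrightarrow> optimal h u (g u)"
  shows "continuous_on U g"
proof -
  obtain B where B: "\<And>z. z \<in> XS \<times> YS \<Longrightarrow> \<bar>h z\<bar> \<le> B"
    using compact_continuous_bounded[OF N.compact h] by (metis real_norm_def)
  have "0 \<le> B"
    using B N.nonempty abs_ge_zero order_trans by blast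
  \<comment> \<open>The bound of \<open>norm_le_of_f_update_ge\<close> with both free constants
    equal to \<open>B\<close>.\<close>
  define R where "R = 2 * A * (\<epsilon> * ln (3 / 2) + C + B + B)"
  have R: "g u \<in> cball 0 R" if u: "u \<in> U" for u
  proof -
    have "- B \<le> f_update (g u) h u"
      using B by (intro optimal_imp_f_update_ge h opt u) (auto simp: abs_le_iff)
    moreover have "(\<integral>z. max (- h z) 0 \<partial>N) \<le> B"
      using B \<open>0 \<le> B\<close> by (intro N.integral_continuous_le continuous_intros h) (force simp: abs_le_iff)
    ultimately show ?thesis
      unfolding R_def mem_cball_0 by (rule norm_le_of_f_update_ge[OF h u \<open>0 \<le> B\<close>])
  qed
  let ?T = "U \<times> cball (0::'x) R"
  define \<Psi> where "\<Psi> s = (\<integral>z. exp (slack (snd s) h (fst s) z / \<epsilon>) *\<^sub>R fst z \<partial>N)" for s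
  have T: "compact ?T"
    by (simp add: compact_Times M.compact)
  have h': "continuous_on (?T \<times> (XS \<times> YS)) (\<lambda>s. h (snd s))"
    by (auto intro!: continuous_on_compose2[OF h] continuous_intros)
  have "continuous_on ?T \<Psi>"
    unfolding \<Psi>_def
    by (intro N.continuous_on_integral T, unfold case_prod_beta slack_def)
      (intro continuous_intros h', use eps_pos in auto)
  then have "closed (?T \<inter> \<Psi> -` {0})"
    by (intro continuous_closed_preimage compact_imp_closed T) auto
  \<comment> \<open>Uniqueness makes the zero set of \<open>\<Psi>\<close> exactly the graph of
    \<open>g\<close>.\<close>
  also have "?T \<inter> \<Psi> -` {0} = (\<lambda>u. (u, g u)) ` U"
    using R opt optimal_unique[OF h] by (auto simp: \<Psi>_def optimal_def[symmetric])
  finally have "closed ((\<lambda>u. (u, g u)) ` U)" .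
  then show ?thesis
    using R by (intro continuous_from_closed_graph[of "cball 0 R"]) auto
qed

lemma L_nonneg: "0 \<le> L"
proof -
  obtain u y where "u \<in> U" "y \<in> YS"
    using M.nonempty N.nonempty by auto
  then show ?thesis
    using norm_sum_le[of u y] norm_ge_zero[of u] norm_ge_zero[of y] by linarith
qed

lemma f_update_continuous:
  assumes h: "continuous_on (XS \<times> YS) h" and opt: "\<And>u. u \<in> U \<Longrightarrow> optimal h u (g u)"
  shows "continuous_on U (\<lambda>u. f_update (g u) h u)"
proof (rule lipschitz_on_continuous_on[of L], rule lipschitz_onI)
  fix u v assume uv: "u \<in> U" "v \<in> U"
  then show "dist (f_update (g u) h u) (f_update (g v) h v) \<le> L * dist u v"
    using f_update_diff_le[OF h uv opt[OF uv(2)], of "g u"]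
      f_update_diff_le[OF h uv(2,1) opt[OF uv(1)], of "g v"]
    by (simp add: dist_norm norm_minus_commute abs_le_iff)
qed (rule L_nonneg)

section \<open>Monotonicity of the dual objective\<close>

lemma continuous_on_joint:
  assumes f: "continuous_on U f" and g: "continuous_on U g" and h: "continuous_on (XS \<times> YS) h"
  shows "continuous_on U (\<lambda>u. \<integral>z. exp ((f u + slack (g u) h u z) / \<epsilon>) \<partial>N)"
    and "continuous_on (XS \<times> YS) (\<lambda>z. \<integral>u. exp ((f u + slack (g u) h u z) / \<epsilon>) \<partial>M)"
proof -
  have 1: "continuous_on (U \<times> (XS \<times> YS)) (\<lambda>s. f (fst s))"
    "continuous_on (U \<times> (XS \<times> YS)) (\<lambda>s. g (fst s))"
    "continuous_on (U \<times> (XS \<times> YS)) (\<lambda>s. h (snd s))"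
    by (auto intro!: continuous_on_compose2[OF f] continuous_on_compose2[OF g]
        continuous_on_compose2[OF h] continuous_intros)
  have 2: "continuous_on ((XS \<times> YS) \<times> U) (\<lambda>s. f (snd s))"
    "continuous_on ((XS \<times> YS) \<times> U) (\<lambda>s. g (snd s))"
    "continuous_on ((XS \<times> YS) \<times> U) (\<lambda>s. h (fst s))"
    by (auto intro!: continuous_on_compose2[OF f] continuous_on_compose2[OF g]
        continuous_on_compose2[OF h] continuous_intros)
  show "continuous_on U (\<lambda>u. \<integral>z. exp ((f u + slack (g u) h u z) / \<epsilon>) \<partial>N)"
    by (intro N.continuous_on_integral M.compact, unfold case_prod_beta slack_def)
      (intro continuous_intros 1, use eps_pos in auto)
  show "continuous_on (XS \<times> YS) (\<lambda>z. \<integral>u. exp ((f u + slack (g u) h u z) / \<epsilon>) \<partial>M)"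
    by (intro M.continuous_on_integral N.compact, unfold case_prod_beta slack_def)
      (intro continuous_intros 2, use eps_pos in auto)
qed

text \<open>Two maximisations for each \<open>u\<close>: \<open>ln x \<le> x - 1\<close> replaces
  \<open>f u\<close> by its optimum for the given \<open>g u\<close>, and optimality then replaces
  \<open>g u\<close> by \<open>w u\<close>. The right side is the dual objective after this update,
  as its exponential term cancels.\<close>

lemma dual_le:
  assumes f: "continuous_on U f" and g: "continuous_on U g" and h: "continuous_on (XS \<times> YS) h"
    and opt: "\<And>u. u \<in> U \<Longrightarrow> optimal h u (w u)"
  shows "dual f g h \<le> (\<integral>u. f_update (w u) h u \<partial>M) + (\<integral>z. h z \<partial>N)"
proof -
  define G where "G u = (\<integral>z. exp ((f u + slack (g u) h u z) / \<epsilon>) \<partial>N)" for u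
  have G: "continuous_on U G"
    unfolding G_def by (rule continuous_on_joint[OF f g h])
  have "(\<integral>u. f u \<partial>M) - \<epsilon> * ((\<integral>u. G u \<partial>M) - 1) = (\<integral>u. f u - \<epsilon> * (G u - 1) \<partial>M)"
    using M.integrable_continuous[OF f] M.integrable_continuous[OF G] by (simp add: M.prob_space)
  also have "\<dots> \<le> (\<integral>u. f_update (w u) h u \<partial>M)"
  proof (intro M.integral_continuous_mono continuous_intros f G f_update_continuous h opt)
    fix u assume u: "u \<in> U"
    define I where "I = (\<integral>z. exp (slack (g u) h u z / \<epsilon>) \<partial>N)"
    have I: "I > 0"
      unfolding I_def using eps_pos by (intro N.integral_exp_pos continuous_intros continuous_on_slack h) auto
    have "G u = exp (f u / \<epsilon>) * I"
      by (simp add: G_def I_def add_divide_distrib exp_add)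
    moreover have "\<epsilon> * (f u / \<epsilon> + ln I) \<le> \<epsilon> * (exp (f u / \<epsilon>) * I - 1)"
      using eps_pos I ln_le_minus_one[of "exp (f u / \<epsilon>) * I"]
      by (intro mult_left_mono) (auto simp: ln_mult)
    ultimately have "f u - \<epsilon> * (G u - 1) \<le> f_update (g u) h u"
      using eps_pos by (simp add: f_update_def algebra_simps flip: I_def)
    also have "\<dots> \<le> f_update (w u) h u"
      by (intro optimal_imp_f_update_le h opt u)
    finally show "f u - \<epsilon> * (G u - 1) \<le> f_update (w u) h u" .
  qed
  finally show ?thesis
    by (simp add: dual_def G_def)
qed

text \<open>After the update of \<open>f\<close> and \<open>g\<close> the exponential weight has
  total mass one, so by Fubini \<open>\<epsilon> * (G z - 1)\<close> can be subtracted without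
  changing the integral, and \<open>le_h_update\<close> applies pointwise.\<close>

lemma integral_le_integral_h_update:
  assumes h: "continuous_on (XS \<times> YS) h" and opt: "\<And>u. u \<in> U \<Longrightarrow> optimal h u (w u)"
  shows "(\<integral>z. h z \<partial>N) \<le> (\<integral>z. h_update (\<lambda>u. f_update (w u) h u) w z \<partial>N)"
proof -
  define f where "f u = f_update (w u) h u" for u
  define G where "G z = (\<integral>u. exp ((f u + slack (w u) h u z) / \<epsilon>) \<partial>M)" for z
  have f: "continuous_on U f"
    unfolding f_def using h opt by (rule f_update_continuous)
  have w: "continuous_on U w"
    using h opt by (rule optimal_continuous)
  have G: "continuous_on (XS \<times> YS) G"
    unfolding G_def by (rule continuous_on_joint[OF f w h])
  have "(\<integral>z. G z \<partial>N) = (\<integral>u. \<integral>z. exp ((f u + slack (w u) h u z) / \<epsilon>) \<partial>N \<partial>M)"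
    unfolding G_def by (rule integral_swap[OF f w h, symmetric])
  also have "\<dots> = 1"
    by (simp add: f_def integral_exp_f_update[OF h] M.prob_space)
  finally have "(\<integral>z. G z \<partial>N) = 1" .
  then have "(\<integral>z. h z \<partial>N) = (\<integral>z. h z - \<epsilon> * (G z - 1) \<partial>N)"
    using N.integrable_continuous[OF h] N.integrable_continuous[OF G] by (simp add: N.prob_space)
  also have "\<dots> \<le> (\<integral>z. h_update f w z \<partial>N)"
    using le_h_update[OF f w]
    by (intro N.integral_continuous_mono continuous_intros h G h_update_continuous f w)
      (simp add: G_def)
  finally show ?thesis
    unfolding f_def[abs_def] .
qed

section \<open>The invariant and one full iteration\<close>

text \<open>
  Invariant of the iteration. The two alternatives describe the initial potential, of which only
  the sup norm is known, and the later ones, which are of the form \<open>h_update f g\<close>.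
\<close>

definition admissible :: "real \<Rightarrow> real \<Rightarrow> ('x \<times> 'y \<Rightarrow> real) \<Rightarrow> bool" where
  "admissible D H h \<longleftrightarrow> continuous_on (XS \<times> YS) h \<and>
     (\<exists>f g. continuous_on U f \<and> continuous_on U g \<and> (\<integral>u. f u \<partial>M) = 0 \<and> D \<le> dual f g h) \<and>
     ((\<forall>z\<in>XS \<times> YS. \<bar>h z\<bar> \<le> H) \<or> ((\<forall>z\<in>XS \<times> YS. h z \<le> C) \<and> D \<le> (\<integral>z. h z \<partial>N)))"

lemma dual_h_update:
  assumes f: "continuous_on U f" and g: "continuous_on U g" and "(\<integral>u. f u \<partial>M) = 0"
  shows "dual f g (h_update f g) = (\<integral>z. h_update f g z \<partial>N)"
  using assms(3)
  by (simp add: dual_def integral_swap[OF f g h_update_continuous[OF f g]]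
      integral_exp_h_update[OF f g] N.prob_space)

text \<open>The new potential satisfies the second alternative of the invariant, and the pair
  \<open>f\<close>, \<open>g\<close> itself witnesses the existential.\<close>

lemma admissible_h_update:
  assumes f: "continuous_on U f" and g: "continuous_on U g"
    and zero: "(\<integral>u. f u \<partial>M) = 0" "(\<integral>u. g u \<partial>M) = 0"
    and D: "D \<le> (\<integral>z. h_update f g z \<partial>N)"
  shows "admissible D H (h_update f g)"
  unfolding admissible_def
  using h_update_continuous[OF f g] h_update_le[OF f g _ zero] D dual_h_update[OF f g zero(1)] f g zero
  by metis

text \<open>The iterates are prescribed on the supports only, so the invariant must be insensitive
  to values elsewhere.\<close>

lemma admissible_cong:
  assumes "\<And>z. z \<in> XS \<times> YS \<Longrightarrow> h z = h' z" and "admissible D H h"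
  shows "admissible D H h'"
proof -
  have [simp]: "(\<integral>z. h z \<partial>N) = (\<integral>z. h' z \<partial>N)"
    using assms(1) by (intro Bochner_Integration.integral_cong) (auto simp: N.space_eq)
  have "(\<integral>z. exp ((f u + slack (g u) h u z) / \<epsilon>) \<partial>N) = (\<integral>z. exp ((f u + slack (g u) h' u z) / \<epsilon>) \<partial>N)"
    for f g u
    using assms(1) by (intro Bochner_Integration.integral_cong) (auto simp: N.space_eq slack_def)
  then have "dual f g h = dual f g h'" for f g
    by (simp add: dual_def)
  moreover have "continuous_on (XS \<times> YS) h \<longleftrightarrow> continuous_on (XS \<times> YS) h'"
    using assms(1) by (intro continuous_on_cong) auto
  ultimately show ?thesis
    using assms by (simp add: admissible_def)
qed

text \<open>The constants \<open>D\<close> and \<open>H\<close> of the invariant are the same before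
  and after the step, so the bounds do not deteriorate along the iteration.\<close>

lemma sinkhorn_step_bounds:
  assumes adm: "admissible D H h" and H: "0 \<le> H"
    and opt: "\<And>u. u \<in> U \<Longrightarrow> optimal h u (gt u)"
    and ft: "\<And>u. u \<in> U \<Longrightarrow> ft u = f_update (gt u) h u"
    and ht: "\<And>z. z \<in> XS \<times> YS \<Longrightarrow> ht z = h_update ft gt z"
    and f': "\<And>u. u \<in> U \<Longrightarrow> f' u = ft u - (\<integral>v. ft v \<partial>M)"
    and g': "\<And>u. u \<in> U \<Longrightarrow> g' u = gt u - (\<integral>v. gt v \<partial>M)"
    and h': "\<And>z. z \<in> XS \<times> YS \<Longrightarrow>
      h' z = ht z + (\<integral>v. ft v \<partial>M) + (\<integral>v. gt v \<partial>M) \<bullet> fst z"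
    and diam: "\<And>u v. u \<in> U \<Longrightarrow> v \<in> U \<Longrightarrow> norm (u - v) \<le> d"
    and X: "\<And>x. x \<in> XS \<Longrightarrow> norm x \<le> X"
    and Kf: "Kf = L * d + C + max (- D) 0 + H"
    and Kg: "Kg = 4 * A * (4 * C - 3 / 2 * D + Kf + H + \<epsilon> * ln (3 / 2))"
  shows "admissible D H h'"
    and "u \<in> U \<Longrightarrow> \<bar>ft u\<bar> \<le> Kf" and "u \<in> U \<Longrightarrow> \<bar>f' u\<bar> \<le> Kf"
    and "u \<in> U \<Longrightarrow> norm (gt u) \<le> Kg" and "u \<in> U \<Longrightarrow> norm (g' u) \<le> Kg"
    and "z \<in> XS \<times> YS \<Longrightarrow> \<bar>ht z\<bar> \<le> C + Kf + Kg * X"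
    and "z \<in> XS \<times> YS \<Longrightarrow> \<bar>h' z\<bar> \<le> C + Kf + Kg * X"
proof -
  define a where "a = (\<integral>v. ft v \<partial>M)"
  define b where "b = (\<integral>v. gt v \<partial>M)"
  define F where "F u = ft u - a" for u
  define G where "G u = gt u - b" for u
  have h: "continuous_on (XS \<times> YS) h"
    using adm by (simp add: admissible_def)
  have gtc: "continuous_on U gt"
    using h opt by (rule optimal_continuous)
  have "continuous_on U (\<lambda>u. f_update (gt u) h u)"
    using h opt by (rule f_update_continuous)
  then have ftc: "continuous_on U ft"
    by (rule continuous_on_eq) (simp add: ft)
  have Fc: "continuous_on U F" and Gc: "continuous_on U G"
    unfolding F_def G_def by (intro continuous_intros ftc gtc)+
  have F0: "(\<integral>u. F u \<partial>M) = 0" and G0: "(\<integral>u. G u \<partial>M) = 0"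
    unfolding F_def G_def a_def b_def
    using M.integrable_continuous[OF ftc] M.integrable_continuous[OF gtc]
    by (simp_all add: M.prob_space)
  have FG: "h_update F G z = h_update ft gt z + a + b \<bullet> fst z" for z
    unfolding F_def G_def by (rule h_update_shift[OF ftc gtc])
  have h'_eq: "h' z = h_update F G z" if "z \<in> XS \<times> YS" for z
    using that by (simp add: h' ht FG a_def b_def)
  obtain f g where fg: "continuous_on U f" "continuous_on U g" and D: "D \<le> dual f g h"
    using adm by (auto simp: admissible_def)
  have ft_int: "(\<integral>u. f_update (gt u) h u \<partial>M) = a"
    unfolding a_def by (intro Bochner_Integration.integral_cong) (auto simp: M.space_eq ft)
  have Da: "D \<le> a + (\<integral>z. h z \<partial>N)"
    using D dual_le[OF fg h opt] ft_int by simp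
  have "h_update (\<lambda>u. f_update (gt u) h u) gt z = h_update ft gt z" for z
    unfolding h_update_def
    by (intro arg_cong[where f = "\<lambda>x. - \<epsilon> * ln x"] Bochner_Integration.integral_cong)
      (auto simp: M.space_eq ft)
  then have hle: "(\<integral>z. h z \<partial>N) \<le> (\<integral>z. h_update ft gt z \<partial>N)"
    using integral_le_integral_h_update[OF h opt] by simp
  \<comment> \<open>The linear term of the shift integrates to zero because X is centred.\<close>
  have int_FG: "(\<integral>z. h_update F G z \<partial>N) = (\<integral>z. h_update ft gt z \<partial>N) + a"
    unfolding FG using mean_zero N.integrable_continuous[OF h_update_continuous[OF ftc gtc]]
      N.integrable_continuous[OF continuous_on_fst[OF continuous_on_id]]
    by (simp add: N.prob_space)
  \<comment> \<open>The right side is the dual objective after both updates and the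
    normalisation.\<close>
  have DFG: "D \<le> (\<integral>z. h_update F G z \<partial>N)"
    using Da hle int_FG by linarith
  have "admissible D H (h_update F G)"
    by (rule admissible_h_update[OF Fc Gc F0 G0 DFG])
  then show "admissible D H h'"
    by (rule admissible_cong[rotated]) (simp add: h'_eq)
  have DC: "D \<le> C"
    using DFG N.integral_continuous_le[OF h_update_continuous[OF Fc Gc] h_update_le[OF Fc Gc _ F0 G0]]
    by simp
  obtain u0 where u0: "u0 \<in> U"
    using M.nonempty by auto
  have "0 \<le> d"
    using diam[OF u0 u0] by simp
  then have Ld: "0 \<le> L * d"
    by (simp add: L_nonneg)
  \<comment> \<open>Optimality at every point bounds the oscillation of \<open>ft\<close> by
    \<open>L * d\<close>, hence also its distance from its mean \<open>a\<close>.\<close>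
  have lip: "ft u - ft v \<le> L * d" if "u \<in> U" "v \<in> U" for u v
  proof -
    have "ft u - ft v \<le> L * norm (u - v)"
      using f_update_diff_le[OF h that opt[OF that(2)], of "gt u"] that by (simp add: ft)
    also have "\<dots> \<le> L * d"
      using diam[OF that] L_nonneg by (intro mult_left_mono)
    finally show ?thesis .
  qed
  have a_le: "a \<le> ft u + L * d" if u: "u \<in> U" for u
    unfolding a_def using lip[OF _ u] by (intro M.integral_continuous_le ftc) (simp add: algebra_simps)
  have a_ge: "ft u - L * d \<le> a" if u: "u \<in> U" for u
    unfolding a_def using lip[OF u] by (intro M.integral_continuous_ge ftc) (simp add: algebra_simps)
  have int_h_cases: "(\<forall>z\<in>XS \<times> YS. \<bar>h z\<bar> \<le> H) \<or>
      ((\<forall>z\<in>XS \<times> YS. h z \<le> C) \<and> D \<le> (\<integral>z. h z \<partial>N))"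
    using adm by (simp add: admissible_def)
  have ft_upper: "ft u \<le> C + max (- D) 0 + H" if "u \<in> U" for u
  proof -
    \<comment> \<open>Each alternative of the invariant bounds the integral of \<open>h\<close> from
      below, which \<open>f_update_le\<close> turns into an upper bound.\<close>
    have "- H \<le> (\<integral>z. h z \<partial>N) \<or> D \<le> (\<integral>z. h z \<partial>N)"
      using int_h_cases N.integral_continuous_ge[OF h, of "- H"] abs_ge_minus_self
      by (metis minus_le_iff order_trans)
    then show ?thesis
      using f_update_le[OF h that, of "gt u"] H that by (auto simp: ft)
  qed
  \<comment> \<open>In the first case the competitor \<open>0\<close> bounds \<open>ft\<close>
    directly. In the second \<open>h\<close> has integral at most \<open>C\<close>, so
    \<open>a\<close> is at least \<open>D - C\<close>, and \<open>ft u\<close> is within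
    \<open>L * d\<close> of \<open>a\<close>.\<close>
  have ft_lower: "- Kf \<le> ft u" if u: "u \<in> U" for u
    using int_h_cases
  proof
    assume "\<forall>z\<in>XS \<times> YS. \<bar>h z\<bar> \<le> H"
    then have "- H \<le> ft u"
      unfolding ft[OF u] by (intro optimal_imp_f_update_ge h opt u) (auto simp: abs_le_iff)
    then show ?thesis
      using Ld C_nonneg by (simp add: Kf)
  next
    assume "(\<forall>z\<in>XS \<times> YS. h z \<le> C) \<and> D \<le> (\<integral>z. h z \<partial>N)"
    then have "(\<integral>z. h z \<partial>N) \<le> C"
      by (intro N.integral_continuous_le h) auto
    then show ?thesis
      using Da a_le[OF u] H by (simp add: Kf)
  qed
  have Kf_ge: "L * d \<le> Kf"
    using C_nonneg H by (simp add: Kf)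
  show ft_bound: "\<bar>ft u\<bar> \<le> Kf" if "u \<in> U" for u
    using ft_upper[OF that] ft_lower[OF that] Ld by (simp add: Kf abs_le_iff)
  have F_bound: "\<bar>F u\<bar> \<le> Kf" if "u \<in> U" for u
    using a_le[OF that] a_ge[OF that] Kf_ge by (simp add: F_def abs_le_iff)
  then show "\<bar>f' u\<bar> \<le> Kf" if "u \<in> U" for u
    using that by (simp add: f' F_def a_def)
  \<comment> \<open>One constant for both alternatives, which give \<open>H\<close> and
    \<open>C - D\<close>. With the summand \<open>C\<close> of \<open>norm_le_of_f_update_ge\<close>
    it makes up \<open>4 * C - 3 / 2 * D + H\<close> in \<open>Kg\<close>.\<close>
  have neg: "(\<integral>z. max (- h z) 0 \<partial>N) \<le> 3 * C - 3 / 2 * D + H"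
    using int_h_cases
  proof
    assume "\<forall>z\<in>XS \<times> YS. \<bar>h z\<bar> \<le> H"
    then have "(\<integral>z. max (- h z) 0 \<partial>N) \<le> H"
      using H by (intro N.integral_continuous_le continuous_intros h) (force simp: abs_le_iff)
    then show ?thesis
      using DC C_nonneg by simp
  next
    assume *: "(\<forall>z\<in>XS \<times> YS. h z \<le> C) \<and> D \<le> (\<integral>z. h z \<partial>N)"
    then have "(\<integral>z. max (- h z) 0 \<partial>N) \<le> (\<integral>z. C - h z \<partial>N)"
      using C_nonneg by (intro N.integral_continuous_mono continuous_intros h) auto
    also have "\<dots> = C - (\<integral>z. h z \<partial>N)"
      using N.integrable_continuous[OF h] by (simp add: N.prob_space)
    finally show ?thesis
      using * DC C_nonneg H by simp
  qed
  \<comment> \<open>\<open>Kg\<close> has the factor 4 instead of 2 so that \<open>gt\<close> and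
    its mean \<open>b\<close> take one half each.\<close>
  have gt_half: "norm (gt u) \<le> Kg / 2" if u: "u \<in> U" for u
  proof -
    have "norm (gt u) \<le> 2 * A * (\<epsilon> * ln (3 / 2) + C + Kf + (3 * C - 3 / 2 * D + H))"
    proof (rule norm_le_of_f_update_ge[OF h u _ _ neg])
      show "0 \<le> Kf" "- Kf \<le> f_update (gt u) h u"
        using ft_lower[OF u] Ld Kf_ge u by (simp_all add: ft)
    qed
    also have "\<dots> = Kg / 2"
      by (simp add: Kg)
    finally show ?thesis .
  qed
  have b_half: "norm b \<le> Kg / 2"
    unfolding b_def by (intro M.norm_integral_continuous_le gtc gt_half)
  then have Kg_nonneg: "0 \<le> Kg"
    using norm_ge_zero[of b] by linarith
  then show gt_bound: "norm (gt u) \<le> Kg" if "u \<in> U" for u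
    using gt_half[OF that] by simp
  have G_bound: "norm (G u) \<le> Kg" if "u \<in> U" for u
    using gt_half[OF that] b_half norm_triangle_ineq4[of "gt u" b] by (simp add: G_def)
  then show "norm (g' u) \<le> Kg" if "u \<in> U" for u
    using that by (simp add: g' G_def b_def)
  show "\<bar>ht z\<bar> \<le> C + Kf + Kg * X" if "z \<in> XS \<times> YS"
    unfolding ht[OF that] using that X
    by (intro abs_h_update_le ftc gtc ft_bound gt_bound) auto
  \<comment> \<open>\<open>h'\<close> is itself an update, of normalised potentials with the same
    bounds, so the shift adds nothing to the constant.\<close>
  show "\<bar>h' z\<bar> \<le> C + Kf + Kg * X" if "z \<in> XS \<times> YS"
    unfolding h'_eq[OF that] using that X
    by (intro abs_h_update_le Fc Gc F_bound G_bound) auto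
qed

end

section \<open>Restriction to the supports\<close>

lemma integral_restrict_space_AE:
  fixes q :: "'a \<Rightarrow> 'b::{banach, second_countable_topology}"
  assumes K: "K \<in> sets M" "AE x in M. x \<in> K" and q: "q \<in> borel_measurable M"
  shows "(\<integral>x. q x \<partial>restrict_space M K) = (\<integral>x. q x \<partial>M)"
proof -
  have "(\<integral>x. q x \<partial>restrict_space M K) = (\<integral>x. indicator K x *\<^sub>R q x \<partial>M)"
    using K(1) by (intro integral_restrict_space) auto
  also have "\<dots> = (\<integral>x. q x \<partial>M)"
    using K q by (intro integral_cong_AE borel_measurable_scaleR borel_measurable_indicator) auto
  finally show ?thesis .
qed

text \<open>Extension by zero makes the integrand a bounded Borel function on the whole product,
  where Fubini applies; the indicators then become restrictions.\<close>

lemma set_integral_Times_eq_restrict: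
  fixes q :: "'a::euclidean_space \<times> 'b::euclidean_space \<Rightarrow> real"
  assumes M: "prob_space M" "sets M = sets borel" and N: "prob_space N" "sets N = sets borel"
    and K: "compact K" and J: "compact J" and q: "continuous_on (K \<times> J) q"
  shows "(LINT s:K \<times> J|M \<Otimes>\<^sub>M N. q s)
       = (\<integral>x. \<integral>y. q (x, y) \<partial>restrict_space N J \<partial>restrict_space M K)"
proof -
  interpret M: prob_space M by fact
  interpret N: prob_space N by fact
  interpret MN: pair_prob_space M N ..
  define p where "p s = indicator (K \<times> J) s *\<^sub>R q s" for s
  have KJ: "compact (K \<times> J)"
    using K J by (rule compact_Times)
  have [simp]: "K \<in> sets M" "J \<in> sets N"
    using M N K J borel_compact by auto
  have "sets (M \<Otimes>\<^sub>M N) = sets borel"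
    using sets_pair_measure_cong[OF M(2) N(2)] unfolding borel_prod .
  moreover have "p \<in> borel_measurable borel"
    unfolding p_def using KJ q by (intro borel_measurable_continuous_on_indicator borel_compact)
  ultimately have "p \<in> borel_measurable (M \<Otimes>\<^sub>M N)"
    by (simp cong: measurable_cong_sets)
  moreover obtain B where "\<forall>s\<in>K \<times> J. norm (q s) \<le> B"
    using compact_continuous_bounded[OF KJ q] by blast
  then have "norm (p s) \<le> max B 0" for s
    by (auto simp: p_def indicator_def le_max_iff_disj)
  ultimately have p: "integrable (M \<Otimes>\<^sub>M N) p"
    by (intro MN.integrable_const_bound[of _ "max B 0"]) auto
  have "(LINT s:K \<times> J|M \<Otimes>\<^sub>M N. q s) = (\<integral>s. p s \<partial>(M \<Otimes>\<^sub>M N))"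
    by (simp add: set_lebesgue_integral_def p_def)
  also have "\<dots> = (\<integral>x. \<integral>y. p (x, y) \<partial>N \<partial>M)"
    using MN.integral_fst'[OF p] by simp
  also have "\<dots> = (\<integral>x. indicator K x *\<^sub>R (\<integral>y. indicator J y *\<^sub>R q (x, y) \<partial>N) \<partial>M)"
    by (simp add: p_def indicator_times mult.assoc)
  also have "\<dots> = (\<integral>x. \<integral>y. q (x, y) \<partial>restrict_space N J \<partial>restrict_space M K)"
    by (simp add: integral_restrict_space)
  finally show ?thesis .
qed

lemma sup_norm_le:
  assumes "\<And>x. x \<in> S \<Longrightarrow> norm (f x) \<le> B"
  shows "sup_norm S f \<le> ereal B"
  unfolding sup_norm_def using assms by (intro SUP_least) simp

text \<open>Compactness makes the supremum finite, so \<open>real_of_ereal\<close> returns it and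
  not its default value 0.\<close>

lemma norm_le_sup_norm:
  assumes "compact S" "continuous_on S f" "x \<in> S"
  shows "norm (f x) \<le> real_of_ereal (sup_norm S f)"
proof -
  obtain B where "\<And>x. x \<in> S \<Longrightarrow> norm (f x) \<le> B"
    using compact_continuous_bounded[OF assms(1,2)] by blast
  then have "sup_norm S f \<le> ereal B"
    by (rule sup_norm_le)
  moreover have ge: "ereal (norm (f x)) \<le> sup_norm S f"
    unfolding sup_norm_def using assms(3) by (rule SUP_upper)
  ultimately show ?thesis
    by (cases "sup_norm S f") auto
qed

lemma le_SUP_continuous:
  fixes q :: "'a::topological_space \<Rightarrow> real"
  assumes "compact S" "continuous_on S q" "x \<in> S"
  shows "q x \<le> (SUP x\<in>S. q x)"
proof (rule cSUP_upper[OF assms(3)])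
  show "bdd_above (q ` S)"
    using compact_imp_bounded[OF compact_continuous_image[OF assms(2,1)]]
    by (rule bounded_imp_bdd_above)
qed

section \<open>Second moments\<close>

lemma inner_second_moment:
  assumes "\<And>i j. integrable P (\<lambda>\<omega>. X \<omega> $ i * X \<omega> $ j)"
  shows "v \<bullet> (second_moment P X *v w) = (\<integral>\<omega>. (v \<bullet> X \<omega>) * (w \<bullet> X \<omega>) \<partial>P)"
proof -
  have "(v \<bullet> X \<omega>) * (w \<bullet> X \<omega>) = (\<Sum>i\<in>UNIV. \<Sum>j\<in>UNIV. v $ i * w $ j * (X \<omega> $ i * X \<omega> $ j))" for \<omega>
    by (simp add: inner_vec_def sum_product mult_ac)
  then have "(\<integral>\<omega>. (v \<bullet> X \<omega>) * (w \<bullet> X \<omega>) \<partial>P)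
      = (\<Sum>i\<in>UNIV. \<Sum>j\<in>UNIV. v $ i * w $ j * (\<integral>\<omega>. X \<omega> $ i * X \<omega> $ j \<partial>P))"
    using assms by (simp add: Bochner_Integration.integral_sum)
  also have "\<dots> = v \<bullet> (second_moment P X *v w)"
    by (simp add: inner_vec_def matrix_vector_mult_def second_moment_def sum_distrib_left mult_ac)
  finally show ?thesis ..
qed

text \<open>
  With \<open>w = \<Sigma>\<^sup>-\<^sup>1 v\<close>, the square of the norm of \<open>v\<close> is the integral of \<open>(v \<bullet> X) * (w \<bullet> X)\<close>.
\<close>

lemma norm_le_onorm_second_moment:
  fixes X :: "'w \<Rightarrow> real ^ 'n"
  assumes P: "prob_space P" and X: "X \<in> borel_measurable P" and B: "AE \<omega> in P. norm (X \<omega>) \<le> B"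
    and inv: "invertible (second_moment P X)"
  shows "norm v \<le> onorm (\<lambda>v. matrix_inv (second_moment P X) *v v) * B * (\<integral>\<omega>. \<bar>v \<bullet> X \<omega>\<bar> \<partial>P)"
proof (cases "v = 0")
  case False
  interpret prob_space P by fact
  note [measurable] = X
  define T where "T = matrix_inv (second_moment P X)"
  define w where "w = T *v v"
  define J where "J = (\<integral>\<omega>. \<bar>v \<bullet> X \<omega>\<bar> \<partial>P)"
  have int: "integrable P (\<lambda>\<omega>. (a \<bullet> X \<omega>) * (b \<bullet> X \<omega>))" for a b
  proof (rule integrable_const_bound[of _ "(norm a * B) * (norm b * B)"])
    show "AE \<omega> in P. norm ((a \<bullet> X \<omega>) * (b \<bullet> X \<omega>)) \<le> (norm a * B) * (norm b * B)"
      using B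
    proof eventually_elim
      case (elim \<omega>)
      have *: "\<bar>c \<bullet> X \<omega>\<bar> \<le> norm c * B" for c
        using Cauchy_Schwarz_ineq2[of c "X \<omega>"] mult_left_mono[OF elim, of "norm c"] by simp
      show ?case
        using mult_mono[OF *[of a] *[of b]] abs_ge_zero order_trans[OF abs_ge_zero *[of a]]
        by (simp add: abs_mult)
    qed
  qed measurable
  have int1: "integrable P (\<lambda>\<omega>. \<bar>v \<bullet> X \<omega>\<bar>)"
  proof (rule integrable_const_bound[of _ "norm v * B"])
    show "AE \<omega> in P. norm \<bar>v \<bullet> X \<omega>\<bar> \<le> norm v * B"
      using B
    proof eventually_elim
      case (elim \<omega>)
      show ?case
        using Cauchy_Schwarz_ineq2[of v "X \<omega>"] mult_left_mono[OF elim, of "norm v"] by simp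
    qed
  qed measurable
  have "integrable P (\<lambda>\<omega>. X \<omega> $ i * X \<omega> $ j)" for i j
    using int[of "axis i 1" "axis j 1"] by (simp add: inner_axis')
  then have "v \<bullet> (second_moment P X *v w) = (\<integral>\<omega>. (v \<bullet> X \<omega>) * (w \<bullet> X \<omega>) \<partial>P)"
    by (rule inner_second_moment)
  \<comment> \<open>\<open>matrix_inv\<close> is a Hilbert choice; invertibility makes it a genuine
    inverse.\<close>
  moreover have "second_moment P X ** T = mat 1"
    using someI_ex[OF inv[unfolded invertible_def]] by (simp add: T_def matrix_inv_def)
  then have "second_moment P X *v w = v"
    by (simp add: w_def matrix_vector_mul_assoc)
  ultimately have "norm v * norm v = (\<integral>\<omega>. (v \<bullet> X \<omega>) * (w \<bullet> X \<omega>) \<partial>P)"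
    by (metis power2_norm_eq_inner power2_eq_square)
  also have "\<dots> \<le> (\<integral>\<omega>. norm w * B * \<bar>v \<bullet> X \<omega>\<bar> \<partial>P)"
  proof (rule integral_mono_AE)
    show "AE \<omega> in P. (v \<bullet> X \<omega>) * (w \<bullet> X \<omega>) \<le> norm w * B * \<bar>v \<bullet> X \<omega>\<bar>"
      using B
    proof eventually_elim
      case (elim \<omega>)
      have "\<bar>w \<bullet> X \<omega>\<bar> \<le> norm w * B"
        using Cauchy_Schwarz_ineq2[of w "X \<omega>"] mult_left_mono[OF elim, of "norm w"] by simp
      then have "\<bar>(v \<bullet> X \<omega>) * (w \<bullet> X \<omega>)\<bar> \<le> norm w * B * \<bar>v \<bullet> X \<omega>\<bar>"
        using mult_left_mono[of "\<bar>w \<bullet> X \<omega>\<bar>" "norm w * B" "\<bar>v \<bullet> X \<omega>\<bar>"]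
        by (simp add: abs_mult mult_ac)
      then show ?case
        by linarith
    qed
  qed (use int int1 in auto)
  also have "\<dots> = norm w * (B * J)"
    by (simp add: J_def)
  also have "\<dots> \<le> (onorm (\<lambda>v. T *v v) * norm v) * (B * J)"
  proof (rule mult_right_mono)
    show "norm w \<le> onorm (\<lambda>v. T *v v) * norm v"
      unfolding w_def by (rule onorm) (rule matrix_vector_mul_bounded_linear)
    \<comment> \<open>Under a probability measure, an almost sure statement that does not involve
      \<open>\<omega>\<close> is simply true.\<close>
    have "AE \<omega> in P. 0 \<le> B"
      using B by eventually_elim (meson norm_ge_zero order_trans)
    then show "0 \<le> B * J"
      by (simp add: J_def)
  qed
  finally have "norm v * norm v \<le> norm v * (onorm (\<lambda>v. T *v v) * B * J)"
    by (simp add: mult_ac)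
  then show ?thesis
    using False by (simp add: T_def J_def mult_le_cancel_left_pos)
qed simp

section \<open>Application to the random vector\<close>

theorem proposition3p1:
  fixes P :: "'w measure"
    and X :: "'w \<Rightarrow> real ^ 'dx" and Y :: "'w \<Rightarrow> real ^ 'dy"
    and \<nu> :: "((real ^ 'dx) \<times> (real ^ 'dy)) measure" and \<mu> :: "(real ^ 'dy) measure"
    and US YS :: "(real ^ 'dy) set" and XS :: "(real ^ 'dx) set"
    and f ft :: "nat \<Rightarrow> real ^ 'dy \<Rightarrow> real"
    and g gt :: "nat \<Rightarrow> real ^ 'dy \<Rightarrow> real ^ 'dx"
    and h ht :: "nat \<Rightarrow> (real ^ 'dx) \<times> (real ^ 'dy) \<Rightarrow> real"
    and \<Sigma>X :: "real ^ 'dx ^ 'dx"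
    and \<epsilon> Mx c_sup Lc D0 h0_sup Kf Kg :: real
  assumes "prob_space P" and "X \<in> borel_measurable P" and "Y \<in> borel_measurable P"
    and "\<nu> = distr P borel (\<lambda>\<omega>. (X \<omega>, Y \<omega>))"
    and "prob_space \<mu>" and "sets \<mu> = sets borel"
    and "US = measure_support \<mu>" and "XS = suppX \<nu>" and "YS = suppY \<nu>"
    and "compact US" and "compact XS" and "compact YS"
    and "(\<integral>\<omega>. X \<omega> \<partial>P) = 0"
    and "\<Sigma>X = second_moment P X" and "invertible \<Sigma>X"
    and "\<epsilon> > 0"
    and "continuous_on US (f 0)" and "(LINT u:US|\<mu>. f 0 u) = 0"
    and "continuous_on US (g 0)" and "(LINT u:US|\<mu>. g 0 u) = 0"
    and "continuous_on (XS \<times> YS) (h 0)"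
    and "\<And>t. sinkhorn_step \<epsilon> \<mu> \<nu> (h t) (ft (Suc t)) (gt (Suc t)) (ht (Suc t))
                (f (Suc t)) (g (Suc t)) (h (Suc t))"
    and "Mx = (SUP x\<in>XS. norm x)"
    and "c_sup = (SUP (u, y)\<in>US \<times> YS. cost u y)"
    and "Lc = (SUP u\<in>US. norm u) + (SUP y\<in>YS. norm y)"
    and "D0 = dual_objective \<epsilon> \<mu> \<nu> (f 0) (g 0) (h 0)"
    and "h0_sup = real_of_ereal (sup_norm (XS \<times> YS) (h 0))"
    and "Kf = Lc * diameter US + c_sup + max (- D0) 0 + h0_sup"
    and "Kg = 4 * onorm (\<lambda>v. matrix_inv \<Sigma>X *v v) * Mx *
                (4 * c_sup - 3 / 2 * D0 + Kf + h0_sup + \<epsilon> * ln (3 / 2))"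
  shows "\<forall>t. max (sup_norm US (ft (Suc t))) (sup_norm US (f (Suc t))) \<le> ereal Kf
           \<and> max (sup_norm US (gt (Suc t))) (sup_norm US (g (Suc t))) \<le> ereal Kg
           \<and> max (sup_norm (XS \<times> YS) (ht (Suc t))) (sup_norm (XS \<times> YS) (h (Suc t)))
               \<le> ereal (c_sup + Kf + Kg * Mx)"
proof -
  define Z where "Z = XS \<times> YS"
  define M where "M = restrict_space \<mu> US"
  define N where "N = restrict_space \<nu> Z"
  define A where "A = onorm (\<lambda>v. matrix_inv \<Sigma>X *v v) * Mx"
  note \<nu> = assms(4) and sets_\<mu> = assms(6) and US = assms(7) and XS = assms(8) and YS = assms(9)
  interpret P: prob_space P by fact
  interpret \<mu>: prob_space \<mu> by fact
  note [measurable] = assms(2,3)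
  have XY: "(\<lambda>\<omega>. (X \<omega>, Y \<omega>)) \<in> borel_measurable P"
    by measurable
  have prob_\<nu>: "prob_space \<nu>"
    unfolding \<nu> by (rule P.prob_space_distr) (rule XY)
  have sets_\<nu>: "sets \<nu> = sets borel"
    by (simp add: \<nu>)
  have fst: "fst \<in> borel_measurable \<nu>" and snd: "snd \<in> borel_measurable \<nu>"
    using borel_measurable_continuous_onI[OF continuous_on_fst[OF continuous_on_id]]
      borel_measurable_continuous_onI[OF continuous_on_snd[OF continuous_on_id]]
    by (simp_all add: measurable_cong_sets[OF sets_\<nu> refl])
  have Z: "compact Z"
    unfolding Z_def by (intro compact_Times assms)
  have Z_meas: "Z \<in> sets \<nu>" and US_meas: "US \<in> sets \<mu>"
    using borel_compact[OF Z] borel_compact[OF \<open>compact US\<close>] by (simp_all add: sets_\<nu> sets_\<mu>)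
  have AE_\<mu>: "AE u in \<mu>. u \<in> US"
    unfolding US by (rule AE_measure_support) (rule sets_\<mu>)
  \<comment> \<open>\<open>XS \<times> YS\<close> may be larger than the support of
    \<open>\<nu>\<close>; it has full measure because both marginals are concentrated on their
    supports.\<close>
  have "AE x in distr \<nu> borel fst. x \<in> XS" "AE y in distr \<nu> borel snd. y \<in> YS"
    unfolding XS YS suppX_def suppY_def by (intro AE_measure_support sets_distr)+
  then have "AE z in \<nu>. fst z \<in> XS" "AE z in \<nu>. snd z \<in> YS"
    using borel_compact[OF \<open>compact XS\<close>] borel_compact[OF \<open>compact YS\<close>]
    by (simp_all add: AE_distr_iff fst snd)
  then have AE_\<nu>: "AE z in \<nu>. z \<in> Z"
    by eventually_elim (simp add: Z_def mem_Times_iff)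
  have integral_P: "(\<integral>z. q z \<partial>N) = (\<integral>\<omega>. q (X \<omega>, Y \<omega>) \<partial>P)" if "q \<in> borel_measurable borel"
    for q :: "(real ^ 'dx) \<times> (real ^ 'dy) \<Rightarrow> 'b::{banach, second_countable_topology}"
  proof -
    have "(\<integral>z. q z \<partial>N) = (\<integral>z. q z \<partial>\<nu>)"
      unfolding N_def using that Z_meas AE_\<nu>
      by (intro integral_restrict_space_AE) (simp_all add: measurable_cong_sets[OF sets_\<nu> refl])
    also have "\<dots> = (\<integral>\<omega>. q (X \<omega>, Y \<omega>) \<partial>P)"
      unfolding \<nu> using XY that by (rule integral_distr)
    finally show ?thesis .
  qed
  have restr_\<mu>: "(LINT u:US|\<mu>. q u) = (\<integral>u. q u \<partial>M)"
    for q :: "real ^ 'dy \<Rightarrow> 'b::{banach, second_countable_topology}"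
    unfolding M_def using US_meas by (intro set_integral_eq_restrict) auto
  have restr_\<nu>: "(LINT z:XS \<times> YS|\<nu>. q z) = (\<integral>z. q z \<partial>N)"
    for q :: "(real ^ 'dx) \<times> (real ^ 'dy) \<Rightarrow> 'b::{banach, second_countable_topology}"
    unfolding N_def Z_def[symmetric] using Z_meas by (intro set_integral_eq_restrict) auto
  have norm_le_Mx: "norm x \<le> Mx" if "x \<in> XS" for x
    unfolding assms(23) using that by (intro le_SUP_continuous assms continuous_intros)
  have "AE z in \<nu>. norm (fst z) \<le> Mx"
    using AE_\<nu> by eventually_elim (auto simp: Z_def intro: norm_le_Mx)
  then have AE_X: "AE \<omega> in P. norm (X \<omega>) \<le> Mx"
    unfolding \<nu>
    by (subst (asm) AE_distr_iff)
      (auto intro!: XY borel_closed closed_Collect_le continuous_intros)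
  interpret entropic_vqr M US N XS YS \<epsilon> A c_sup Lc
  proof (intro entropic_vqr.intro entropic_vqr_axioms.intro)
    show "compact_prob_space M US"
      unfolding M_def using assms sets_\<mu> AE_\<mu> by (intro compact_prob_space_restrict)
    show "compact_prob_space N (XS \<times> YS)"
      unfolding N_def using prob_\<nu> sets_\<nu> Z AE_\<nu> unfolding Z_def
      by (intro compact_prob_space_restrict)
    show "(\<integral>z. fst z \<partial>N) = 0"
      using integral_P[of fst] borel_measurable_continuous_onI[OF continuous_on_fst[OF continuous_on_id]]
        assms(13) by simp
    show "norm v \<le> A * (\<integral>z. \<bar>v \<bullet> fst z\<bar> \<partial>N)" for v
    proof -
      have "(\<lambda>z::(real ^ 'dx) \<times> (real ^ 'dy). \<bar>v \<bullet> fst z\<bar>) \<in> borel_measurable borel"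
        by (intro borel_measurable_continuous_onI continuous_intros)
      then have "(\<integral>z. \<bar>v \<bullet> fst z\<bar> \<partial>N) = (\<integral>\<omega>. \<bar>v \<bullet> X \<omega>\<bar> \<partial>P)"
        by (simp add: integral_P)
      then show ?thesis
        using norm_le_onorm_second_moment[OF assms(1,2) AE_X, of v] assms(14,15)
        by (simp add: A_def)
    qed
    show "cost u y \<le> c_sup" if "u \<in> US" "y \<in> YS" for u y
    proof -
      have "continuous_on (US \<times> YS) (\<lambda>(u, y). cost u y)"
        unfolding case_prod_beta by (intro continuous_intros)
      from le_SUP_continuous[OF compact_Times[OF assms(10,12)] this, of "(u, y)"] that
      show ?thesis
        by (simp add: assms(24))
    qed
    show "norm u + norm y \<le> Lc" if "u \<in> US" "y \<in> YS" for u y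
      unfolding assms(25) using that
      by (intro add_mono le_SUP_continuous assms continuous_intros)
  qed (rule \<open>\<epsilon> > 0\<close>)
  \<comment> \<open>These equations let \<open>sinkhorn_step\<close> unfold to the moment condition
    and updates of the locale.\<close>
  have weights: "(\<lambda>(x, y). exp ((w \<bullet> x + k (x, y) - cost u y) / \<epsilon>)) = (\<lambda>z. exp (slack w k u z / \<epsilon>))"
    "(\<lambda>(x, y). exp ((w \<bullet> x + k (x, y) - cost u y) / \<epsilon>) *\<^sub>R x) = (\<lambda>z. exp (slack w k u z / \<epsilon>) *\<^sub>R fst z)"
    for w k u
    by (auto simp: slack_def)
  have step: "\<forall>u\<in>US. optimal (h t) u (gt (Suc t) u)"
    "\<forall>u\<in>US. ft (Suc t) u = f_update (gt (Suc t) u) (h t) u"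
    "\<forall>z\<in>XS \<times> YS. ht (Suc t) z = h_update (ft (Suc t)) (gt (Suc t)) z"
    "\<forall>u\<in>US. f (Suc t) u = ft (Suc t) u - (\<integral>v. ft (Suc t) v \<partial>M)"
    "\<forall>u\<in>US. g (Suc t) u = gt (Suc t) u - (\<integral>v. gt (Suc t) v \<partial>M)"
    "\<forall>z\<in>XS \<times> YS. h (Suc t) z
      = ht (Suc t) z + (\<integral>v. ft (Suc t) v \<partial>M) + (\<integral>v. gt (Suc t) v \<partial>M) \<bullet> fst z" for t
    using assms(22)[of t]
    unfolding sinkhorn_step_def US[symmetric] XS[symmetric] YS[symmetric] weights restr_\<mu> restr_\<nu>
    by (auto simp: optimal_def f_update_def h_update_def)
  have h0_bound: "\<bar>h 0 z\<bar> \<le> h0_sup" if "z \<in> XS \<times> YS" for z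
    unfolding assms(27) real_norm_def[symmetric] using Z that
    by (intro norm_le_sup_norm assms) (simp_all add: Z_def)
  have h0_sup: "0 \<le> h0_sup"
    using N.nonempty h0_bound abs_ge_zero order_trans by blast
  have D0: "D0 = dual (f 0) (g 0) (h 0)"
  proof -
    define q where "q s = exp ((f 0 (fst s) + slack (g 0 (fst s)) (h 0) (fst s) (snd s)) / \<epsilon>)" for s
    have cont: "continuous_on (US \<times> Z) (\<lambda>s. f 0 (fst s))" "continuous_on (US \<times> Z) (\<lambda>s. g 0 (fst s))"
      "continuous_on (US \<times> Z) (\<lambda>s. h 0 (snd s))"
      unfolding Z_def
      by (auto intro!: continuous_on_compose2[OF assms(17)] continuous_on_compose2[OF assms(19)]
          continuous_on_compose2[OF assms(21)] continuous_intros)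
    have "continuous_on (US \<times> Z) q"
      unfolding q_def slack_def by (intro continuous_intros cont) (use eps_pos in auto)
    then have q_int: "(LINT s:US \<times> Z|\<mu> \<Otimes>\<^sub>M \<nu>. q s) = (\<integral>u. \<integral>z. q (u, z) \<partial>N \<partial>M)"
      unfolding M_def N_def
      by (intro set_integral_Times_eq_restrict assms prob_\<nu> sets_\<nu> Z)
    have q_eq: "(\<lambda>(u, x, y). exp ((f 0 u + g 0 u \<bullet> x + h 0 (x, y) - cost u y) / \<epsilon>)) = q"
      by (auto simp: q_def slack_def algebra_simps)
    show ?thesis
      unfolding assms(26) dual_objective_def dual_def US[symmetric] XS[symmetric] YS[symmetric]
        restr_\<mu> restr_\<nu> q_eq q_int[unfolded Z_def]
      by (simp add: q_def)
  qed
  have zero: "(\<integral>u. f 0 u \<partial>M) = 0"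
    using assms(18) by (simp add: restr_\<mu>)
  have diam: "norm (u - v) \<le> diameter US" if "u \<in> US" "v \<in> US" for u v
    using diameter_bounded_bound[OF compact_imp_bounded[OF \<open>compact US\<close>] that] by (simp add: dist_norm)
  have Kg: "Kg = 4 * A * (4 * c_sup - 3 / 2 * D0 + Kf + h0_sup + \<epsilon> * ln (3 / 2))"
    by (simp add: assms(29) A_def)
  note bounds = sinkhorn_step_bounds[OF _ h0_sup step(1)[rule_format] step(2)[rule_format]
      step(3)[rule_format] step(4)[rule_format] step(5)[rule_format] step(6)[rule_format]
      diam norm_le_Mx assms(28) Kg]
  have adm: "admissible D0 h0_sup (h t)" for t
  proof (induction t)
    case 0
    \<comment> \<open>The initial potential satisfies the first alternative, with the initial
      \<open>f\<close> and \<open>g\<close> as witnesses and equality in the dual bound.\<close>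
    show ?case
      unfolding admissible_def using assms(17,19,21) zero D0 h0_bound by blast
  next
    case (Suc t)
    then show ?case
      by (rule bounds(1))
  qed
  show ?thesis
    by (intro allI conjI max.boundedI sup_norm_le)
      (simp_all add: bounds(2-)[OF adm] del: mem_Times_iff)
qed

end
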